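(* Consider the bivariate compound autoregressive model $$X\mid Y\;\overset{d}{=}\;\sum_{i=1}^{Y}Z_i+\epsilon,\qquad Y\mid X\;\overset{d}{=}\;\sum_{i=1}^{X}W_i+\eta .$$ The joint distribution of $(X,Y)$ satisfies this model, where $Z_i,W_i,\epsilon,\eta,X,Y$ have finite moments of all integer orders and the support of $(X,Y)$ is the entire space $\mathbb{N}_0^2$, if and only if one of the following cases is satisfied. **Case (i).** $(Z_i)$ and $(W_i)$ are Bernoulli with probability parameters $\alpha$ and $\beta$, respectively, and $\epsilon,\eta$ are Poisson with parameters $\lambda_\epsilon,\lambda_\eta$ satisfying $$\frac{\alpha}{\lambda_\epsilon(1-\alpha)}=\frac{\beta}{\lambda_\eta(1-\beta)}.$$ In this case $X$ and $Y$ are also marginally Poisson, with parameters $\lambda_X=\frac{\alpha\lambda_\eta+\lambda_\epsilon}{1-\alpha\beta}$ and $\lambda_Y=\frac{\beta\lambda_\epsilon+\lambda_\eta}{1-\alpha\beta}$, and the conditional expectations are $\mathbb{E}[X\mid Y]=\alpha Y+\lambda_\epsilon$ and $\mathbb{E}[Y\mid X]=\beta X+\lambda_\eta$. **Case (ii).** The probability generating functions of $Z_i,\epsilon,W_i,\eta$ are $$\mathbb{E}[u^{Z_i}]=\frac{1+\theta_2(1-u)}{1+\theta_1(1-u)},\quad \mathbb{E}[u^{\epsilon}]=\frac{1}{(1+\theta_1(1-u))^\delta},\quad \mathbb{E}[v^{W_i}]=\frac{1+\theta_4(1-v)}{1+\theta_3(1-v)},\quad \mathbb{E}[v^{\eta}]=\frac{1}{(1+\theta_3(1-v))^\delta},$$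 where $\delta>0$, $\theta_1>0$, $\theta_2>-1$, $\theta_3>0$, $\theta_4>-1$, $\theta_1>\theta_2$, $\theta_3>\theta_4$, and the following two extra constraints hold: $$\theta_4[\theta_1+\theta_3(\theta_1-\theta_2)]=\theta_2[\theta_3+\theta_1(\theta_3-\theta_4)],\qquad (\theta_1-\theta_2)(\theta_3-\theta_4)<1.$$ In this case, writing $\Delta=1-(\theta_1-\theta_2)(\theta_3-\theta_4)$, $\theta_X=\frac{\theta_1+\theta_3(\theta_1-\theta_2)}{\Delta}$ and $\theta_Y=\frac{\theta_3+\theta_1(\theta_3-\theta_4)}{\Delta}$, both $X$ and $Y$ have negative binomial marginals with $$\mathbb{E}[u^X]=\frac{1}{[1+\theta_X(1-u)]^\delta},\qquad \mathbb{E}[v^Y]=\frac{1}{[1+\theta_Y(1-v)]^\delta},$$ the joint probability generating function is $$\mathbb{E}[u^Xv^Y]=\frac{1}{\big[1+\theta_X(1-u)+\theta_Y(1-v)+\theta_4\theta_X(1-u)(1-v)\big]^\delta},\qquad\text{where } \theta_4\theta_X=\theta_2\theta_Y,$$ and the conditional expectations are $\mathbb{E}[X\mid Y]=(\theta_1-\theta_2)Y+\delta\theta_1$ and $\mathbb{E}[Y\mid X]=(\theta_3-\theta_4)X+\delta\theta_3$. In the special case $\theta_2=\theta_4=0$ one recovers the Poisson-gamma conjugacy model: $U$ is gamma distributed (with shape parameter $\delta$) and, given $U$, $X$ and $Y$ are conditionally independent and Poisson distributed with parameters $\lambda_1U$ and $\lambda_2U$.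
   Context: $\mathbb{N}_0=\{0,1,2,\dots\}$; $X,Y,Z_i,W_i,\epsilon,\eta$ are count ($\mathbb{N}_0$-valued) variables. In the model, $(Z_i)$ and $(W_i)$ are two sequences of i.i.d. random variables, $\epsilon$ is independent of $(Z_i)$ and $\eta$ is independent of $(W_i)$, and $\overset{d}{=}$ denotes equality in distribution. Equivalently, the model reads $\mathbb{E}[u^X\mid Y]=(\mathbb{E}[u^{Z_1}])^Y\,\mathbb{E}[u^\epsilon]$ and $\mathbb{E}[v^Y\mid X]=(\mathbb{E}[v^{W_1}])^X\,\mathbb{E}[v^\eta]$.
   Formalization: The "only if" direction assumes that Z_i and W_i are not both almost surely 0; otherwise X=ε and Y=η are independent with arbitrary fully supported laws having all moments (e.g. geometric and Poisson), which fall in neither case. *)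

theory Defs
  imports "HOL-Probability.Probability"
begin

definition pgf :: "nat pmf \<Rightarrow> real \<Rightarrow> real" where
  "pgf q u = measure_pmf.expectation q (\<lambda>n. u ^ n)"

definition joint_pgf :: "(nat \<times> nat) pmf \<Rightarrow> real \<Rightarrow> real \<Rightarrow> real" where
  "joint_pgf p u v = measure_pmf.expectation p (\<lambda>(x, y). u ^ x * v ^ y)"

definition finite_moments :: "nat pmf \<Rightarrow> bool" where
  "finite_moments q \<longleftrightarrow> (\<forall>k. integrable (measure_pmf q) (\<lambda>n. real n ^ k))"

text \<open>The law of \<open>Z\<^sub>1 + \<dots> + Z\<^sub>n + \<epsilon>\<close>, where the \<open>Z\<^sub>i\<close> are i.i.d. with law \<open>Z\<close> and \<open>\<epsilon>\<close> is independent
  of them. The second argument of \<^const>\<open>Pi_pmf\<close> is the value of the random function outside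
  \<open>{1..n}\<close>, which is not used.\<close>

definition compound_pmf :: "nat pmf \<Rightarrow> nat pmf \<Rightarrow> nat \<Rightarrow> nat pmf" where
  "compound_pmf Z \<epsilon> n =
     map_pmf (\<lambda>(z, e). (\<Sum>i=1..n. z i) + e) (pair_pmf (Pi_pmf {1..n} 0 (\<lambda>_. Z)) \<epsilon>)"

text \<open>A joint law \<open>p\<close> of \<open>(X, Y)\<close> has \<open>X\<close> as first and \<open>Y\<close> as second component. The following are the
  conditional laws of \<open>X\<close> given \<open>Y = y\<close> and of \<open>Y\<close> given \<open>X = x\<close>. As usual for \<^const>\<open>cond_pmf\<close>, they
  are meaningful only if the conditioning event has positive probability.\<close>

definition X_given_Y :: "(nat \<times> nat) pmf \<Rightarrow> nat \<Rightarrow> nat pmf" where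
  "X_given_Y p y = map_pmf fst (cond_pmf p {\<omega>. snd \<omega> = y})"

definition Y_given_X :: "(nat \<times> nat) pmf \<Rightarrow> nat \<Rightarrow> nat pmf" where
  "Y_given_X p x = map_pmf snd (cond_pmf p {\<omega>. fst \<omega> = x})"

definition bivariate_car ::
  "(nat \<times> nat) pmf \<Rightarrow> nat pmf \<Rightarrow> nat pmf \<Rightarrow> nat pmf \<Rightarrow> nat pmf \<Rightarrow> bool" where
  "bivariate_car p Z \<epsilon> W \<eta> \<longleftrightarrow>
     (\<forall>y\<in>set_pmf (map_pmf snd p). X_given_Y p y = compound_pmf Z \<epsilon> y) \<and>
     (\<forall>x\<in>set_pmf (map_pmf fst p). Y_given_X p x = compound_pmf W \<eta> x)"

definition regular_bivariate_car ::
  "(nat \<times> nat) pmf \<Rightarrow> nat pmf \<Rightarrow> nat pmf \<Rightarrow> nat pmf \<Rightarrow> nat pmf \<Rightarrow> bool" where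
  "regular_bivariate_car p Z \<epsilon> W \<eta> \<longleftrightarrow>
     bivariate_car p Z \<epsilon> W \<eta> \<and>
     finite_moments (map_pmf fst p) \<and> finite_moments (map_pmf snd p) \<and>
     finite_moments Z \<and> finite_moments \<epsilon> \<and> finite_moments W \<and> finite_moments \<eta> \<and>
     set_pmf p = UNIV"

text \<open>The bounds on the parameters are what makes the laws and the constraint meaningful:
  \<^const>\<open>poisson_pmf\<close> is specified for positive rates only, and \<open>\<alpha> = 1\<close> or \<open>\<beta> = 1\<close> would divide by zero.\<close>

definition poisson_case ::
  "nat pmf \<Rightarrow> nat pmf \<Rightarrow> nat pmf \<Rightarrow> nat pmf \<Rightarrow> real \<Rightarrow> real \<Rightarrow> real \<Rightarrow> real \<Rightarrow> bool" where
  "poisson_case Z \<epsilon> W \<eta> \<alpha> \<beta> l\<^sub>\<epsilon> l\<^sub>\<eta> \<longleftrightarrow>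
     0 \<le> \<alpha> \<and> \<alpha> < 1 \<and> 0 \<le> \<beta> \<and> \<beta> < 1 \<and> 0 < l\<^sub>\<epsilon> \<and> 0 < l\<^sub>\<eta> \<and>
     Z = map_pmf of_bool (bernoulli_pmf \<alpha>) \<and> W = map_pmf of_bool (bernoulli_pmf \<beta>) \<and>
     \<epsilon> = poisson_pmf l\<^sub>\<epsilon> \<and> \<eta> = poisson_pmf l\<^sub>\<eta> \<and>
     \<alpha> / (l\<^sub>\<epsilon> * (1 - \<alpha>)) = \<beta> / (l\<^sub>\<eta> * (1 - \<beta>))"

definition neg_binomial_case ::
  "nat pmf \<Rightarrow> nat pmf \<Rightarrow> nat pmf \<Rightarrow> nat pmf \<Rightarrow> real \<Rightarrow> real \<Rightarrow> real \<Rightarrow> real \<Rightarrow> real \<Rightarrow> bool" where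
  "neg_binomial_case Z \<epsilon> W \<eta> \<delta> \<theta>\<^sub>1 \<theta>\<^sub>2 \<theta>\<^sub>3 \<theta>\<^sub>4 \<longleftrightarrow>
     \<delta> > 0 \<and> \<theta>\<^sub>1 > 0 \<and> \<theta>\<^sub>2 > -1 \<and> \<theta>\<^sub>3 > 0 \<and> \<theta>\<^sub>4 > -1 \<and> \<theta>\<^sub>1 > \<theta>\<^sub>2 \<and> \<theta>\<^sub>3 > \<theta>\<^sub>4 \<and>
     (\<forall>u\<in>{0..1}. pgf Z u = (1 + \<theta>\<^sub>2 * (1 - u)) / (1 + \<theta>\<^sub>1 * (1 - u))) \<and>
     (\<forall>u\<in>{0..1}. pgf \<epsilon> u = 1 / (1 + \<theta>\<^sub>1 * (1 - u)) powr \<delta>) \<and>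
     (\<forall>v\<in>{0..1}. pgf W v = (1 + \<theta>\<^sub>4 * (1 - v)) / (1 + \<theta>\<^sub>3 * (1 - v))) \<and>
     (\<forall>v\<in>{0..1}. pgf \<eta> v = 1 / (1 + \<theta>\<^sub>3 * (1 - v)) powr \<delta>) \<and>
     \<theta>\<^sub>4 * (\<theta>\<^sub>1 + \<theta>\<^sub>3 * (\<theta>\<^sub>1 - \<theta>\<^sub>2)) = \<theta>\<^sub>2 * (\<theta>\<^sub>3 + \<theta>\<^sub>1 * (\<theta>\<^sub>3 - \<theta>\<^sub>4)) \<and>
     (\<theta>\<^sub>1 - \<theta>\<^sub>2) * (\<theta>\<^sub>3 - \<theta>\<^sub>4) < 1"

text \<open>Density of the gamma distribution with shape \<open>\<delta>\<close> and rate \<open>r\<close>.\<close>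

definition gamma_density :: "real \<Rightarrow> real \<Rightarrow> real \<Rightarrow> real" where
  "gamma_density \<delta> r t =
     (if t \<le> 0 then 0 else r powr \<delta> / Gamma \<delta> * t powr (\<delta> - 1) * exp (- r * t))"

text \<open>The law of \<open>(X, Y)\<close> when \<open>U\<close> is gamma distributed with shape \<open>\<delta>\<close> and rate \<open>r\<close> and, given \<open>U = t\<close>,
  the variables \<open>X\<close> and \<open>Y\<close> are independent and Poisson with parameters \<open>l\<^sub>1 * t\<close> and \<open>l\<^sub>2 * t\<close>.
  The unspecified values of \<^const>\<open>poisson_pmf\<close> for \<open>t \<le> 0\<close> are multiplied by density \<open>0\<close>.\<close>

definition poisson_gamma_law :: "(nat \<times> nat) pmf \<Rightarrow> real \<Rightarrow> real \<Rightarrow> real \<Rightarrow> real \<Rightarrow> bool" where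
  "poisson_gamma_law p \<delta> r l\<^sub>1 l\<^sub>2 \<longleftrightarrow>
     (\<forall>\<omega>. pmf p \<omega> = (LINT t|lborel. gamma_density \<delta> r t *
             pmf (pair_pmf (poisson_pmf (l\<^sub>1 * t)) (poisson_pmf (l\<^sub>2 * t))) \<omega>))"

end

theory Submission
  imports Defs
begin

text \<open>
  Write \<open>f, g, h, k\<close> for the generating functions of \<open>Z, \<epsilon>, W, \<eta>\<close>. The model says
  \<open>P(X = x, Y = y) = P(Y = y) [u\<^sup>x] f(u)\<^sup>y g(u) = P(X = x) [v\<^sup>y] h(v)\<^sup>x k(v)\<close>. The coefficients of
  \<open>1, v, v\<^sup>2\<close> in \<open>h(v)\<^sup>x k(v)\<close> are \<open>h(0)\<^sup>x\<close> times polynomials in \<open>x\<close> of degree \<open>0, 1, 2\<close>, so these three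
  rows express \<open>f g\<close> and \<open>f\<^sup>2 g\<close> through \<open>g, u g', u\<^sup>2 g''\<close>, and eliminating \<open>f\<close> leaves
  \<open>g g'' = (1 + C) g'\<^sup>2\<close>. Hence \<open>(1 - C q u) g' = q g\<close>: \<open>g\<close> is Poisson for \<open>C = 0\<close> and negative binomial
  for \<open>C > 0\<close>, and \<open>f\<close> is linear, respectively linear fractional. The same argument for the columns
  gives the same \<open>C\<close>, and summability of the marginal laws gives the inequalities between the parameters.
  Conversely, the two sides of \<open>G\<^sub>Y (v f(u)) g(u) = G\<^sub>X (u h(v)) k(v)\<close> agree in both cases, and since all
  probabilities are positive the conditional laws determine the joint law.
\<close>

section \<open>Probability generating functions\<close>

text \<open>The pair \<open>Z = W = return_pmf 0\<close> has to be set aside in the necessity half: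
  there X and Y are independent, and \<epsilon>, \<eta> can be any laws with full support and finite
  moments. Otherwise both \<open>Z\<close> and \<open>W\<close> charge 1, and the second-order
  equation is nontrivial. Conditional laws prescribe coefficients, so the equation is derived for
  formal power series, without convergence; real generating functions serve to identify laws. The
  equation comes from (f g)^2 = (f^2 g) g. Its lowest coefficient removes the g g' term, and
  comparing the two remaining terms gives 1 + C = 2 k_0 k_2 / k_1^2. The recursion found for g gives
  2 g_0 g_2 / g_1^2 the same value, which is why rows and columns share C. The bound on the product
  of the two slopes is a normalizability condition: the law of X is proportional to g_x / h(0)^x, so
  dividing by h(0)^x must leave a limiting ratio below 1, and likewise for Y.\<close>

text \<open>Once the coefficients below n vanish, dividing by u^n leaves a power series whose limit
  at 0 is \<open>d n\<close>. Limits from the right suffice, which suits generating functions known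
  only on [0,1].\<close>

lemma powser_eq_0_imp_coeff_eq_0:
  fixes d :: "nat \<Rightarrow> real"
  assumes "r > 0" and s: "summable (\<lambda>n. d n * r ^ n)"
    and zero: "\<And>u. 0 < u \<Longrightarrow> u < r \<Longrightarrow> (\<lambda>n. d n * u ^ n) sums 0"
  shows "d n = 0"
proof (induction n rule: less_induct)
  case (less n)
  have 1: "summable (\<lambda>m. d (m + n) * r ^ m)"
  proof -
    have "summable (\<lambda>m. d (m + n) * r ^ (m + n))"
      using s by (subst summable_iff_shift)
    then have "summable (\<lambda>m. d (m + n) * r ^ (m + n) * (1 / r ^ n))"
      by (rule summable_mult2)
    then show ?thesis using \<open>r > 0\<close> by (simp add: power_add field_simps)
  qed
  have "isCont (\<lambda>x. \<Sum>m. d (m + n) * x ^ m) 0"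
    by (rule isCont_powser[OF 1]) (use \<open>r > 0\<close> in simp)
  then have "((\<lambda>x. \<Sum>m. d (m + n) * x ^ m) \<longlongrightarrow> (\<Sum>m. d (m + n) * 0 ^ m)) (at_right 0)"
    unfolding isCont_def by (rule filterlim_at_split[THEN iffD1, THEN conjunct2])
  then have 2: "((\<lambda>x. \<Sum>m. d (m + n) * x ^ m) \<longlongrightarrow> d n) (at_right 0)"
    by (simp add: powser_zero)
  have "(\<Sum>m. d (m + n) * u ^ m) = 0" if "0 < u" "u < r" for u
  proof -
    have "(\<lambda>m. d (m + n) * u ^ (m + n)) sums 0"
      using zero[OF that] less
      by (subst sums_iff_shift) (simp add: sum.neutral)
    then have "(\<lambda>m. d (m + n) * u ^ (m + n) * (1 / u ^ n)) sums (0 * (1 / u ^ n))"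
      by (rule sums_mult2)
    then have "(\<lambda>m. d (m + n) * u ^ m) sums 0" using that by (simp add: power_add field_simps)
    then show ?thesis by (simp add: sums_iff)
  qed
  then have "eventually (\<lambda>u. (\<Sum>m. d (m + n) * u ^ m) = 0) (at_right 0)"
    using \<open>r > 0\<close> by (auto simp: eventually_at_right)
  then have "((\<lambda>x. \<Sum>m. d (m + n) * x ^ m) \<longlongrightarrow> 0) (at_right 0)"
    by (rule tendsto_eventually)
  then show ?case using 2 tendsto_unique[OF trivial_limit_at_right_real] by blast
qed

lemma powser_coeff_unique:
  fixes a b :: "nat \<Rightarrow> real"
  assumes "r > 0"
    and a: "\<And>u. 0 < u \<Longrightarrow> u \<le> r \<Longrightarrow> (\<lambda>n. a n * u ^ n) sums s u"
    and b: "\<And>u. 0 < u \<Longrightarrow> u \<le> r \<Longrightarrow> (\<lambda>n. b n * u ^ n) sums s u"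
  shows "a = b"
proof
  fix n
  have *: "(\<lambda>n. (a n - b n) * u ^ n) sums 0" if "0 < u" "u \<le> r" for u
    using sums_diff[OF a[OF that] b[OF that]] by (simp add: algebra_simps)
  have "a n - b n = 0"
    by (rule powser_eq_0_imp_coeff_eq_0[OF \<open>r > 0\<close>])
      (use * \<open>r > 0\<close> in \<open>auto simp: sums_iff\<close>)
  then show "a n = b n" by simp
qed

section \<open>Generating functions of laws on the natural numbers\<close>

lemma integrable_pmf_nat_iff:
  fixes f :: "nat \<Rightarrow> real"
  shows "integrable (measure_pmf q) f \<longleftrightarrow> summable (\<lambda>n. \<bar>pmf q n * f n\<bar>)"
  unfolding measure_pmf_eq_density
  by (subst integrable_density) (auto simp: integrable_count_space_nat_iff)

lemma expectation_nat_sums: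
  fixes f :: "nat \<Rightarrow> real"
  assumes "integrable (measure_pmf q) f"
  shows "(\<lambda>n. pmf q n * f n) sums measure_pmf.expectation q f"
proof -
  have "integrable (count_space UNIV) (\<lambda>n. pmf q n * f n)"
    using assms by (simp add: integrable_pmf_nat_iff integrable_count_space_nat_iff)
  from sums_integral_count_space_nat[OF this] show ?thesis
    unfolding measure_pmf_eq_density by (subst integral_density) auto
qed

lemma pmf_nat_sums: "pmf q sums (1 :: real)" for q :: "nat pmf"
  using expectation_nat_sums[of q "\<lambda>_. 1"] by simp

lemma integrable_pgf:
  assumes "0 \<le> u" "u \<le> 1"
  shows "integrable (measure_pmf q) (\<lambda>n::nat. u ^ n :: real)"
  by (rule measure_pmf.integrable_const_bound[where B = 1])
    (use assms in \<open>auto simp: power_le_one\<close>)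

lemma pgf_sums:
  assumes "0 \<le> u" "u \<le> 1"
  shows "(\<lambda>n. pmf q n * u ^ n) sums pgf q u"
  unfolding pgf_def by (rule expectation_nat_sums[OF integrable_pgf[OF assms]])

lemma pgf_nonneg: "0 \<le> u \<Longrightarrow> 0 \<le> pgf q u"
  unfolding pgf_def by simp

lemma pgf_le_1:
  assumes "0 \<le> u" "u \<le> 1"
  shows "pgf q u \<le> 1"
proof -
  have "pgf q u \<le> measure_pmf.expectation q (\<lambda>_. 1)"
    unfolding pgf_def
    by (rule integral_mono[OF integrable_pgf[OF assms]]) (use assms in \<open>auto simp: power_le_one\<close>)
  then show ?thesis by simp
qed

lemma pmf_nat_eqI_pgf:
  assumes "\<And>u. 0 < u \<Longrightarrow> u \<le> 1 \<Longrightarrow> (\<lambda>n. a n * u ^ n) sums pgf q u"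
  shows "pmf q = a"
  by (rule powser_coeff_unique[where r = 1 and s = "pgf q"]) (use assms pgf_sums in auto)

lemma pgf_eqI:
  assumes "\<And>n. pmf q n = a n" "(\<lambda>n. a n * u ^ n) sums s" "0 \<le> u" "u \<le> 1"
  shows "pgf q u = s"
  using sums_unique2[OF pgf_sums[OF assms(3,4)], of q s] assms(1,2) by simp

lemma summable_real_powser:
  fixes a :: "nat \<Rightarrow> real"
  assumes "summable a" "\<And>n. a n \<ge> 0" "0 \<le> u" "u \<le> 1"
  shows "summable (\<lambda>n. a n * u ^ n)"
  by (rule summable_comparison_test'[OF assms(1), of 0])
    (use assms in \<open>auto simp: abs_mult mult_left_le power_le_one\<close>)

section \<open>Joint generating functions\<close>

text \<open>The double series is dominated by \<open>pmf p\<close>, so Fubini allows summing over x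
  first. This order exhibits the joint generating function as a power series in v.\<close>

lemma joint_pgf_eq_suminf_snd:
  assumes "0 \<le> u" "u \<le> 1" "0 \<le> v" "v \<le> 1"
  shows "summable (\<lambda>y. (\<Sum>x. pmf p (x, y) * u ^ x) * v ^ y)" (is ?S)
    and "joint_pgf p u v = (\<Sum>y. (\<Sum>x. pmf p (x, y) * u ^ x) * v ^ y)" (is ?E)
    and "summable (\<lambda>x. pmf p (x, y) * u ^ x)" (is ?T)
proof -
  let ?f = "\<lambda>(x, y). pmf p (x, y) * (u ^ x * v ^ y)"
  have 1: "Infinite_Set_Sum.abs_summable_on ?f UNIV"
    by (rule abs_summable_on_comparison_test[OF pmf_abs_summable[of p]])
      (use assms in \<open>auto simp: mult_left_le abs_mult mult_le_one power_le_one\<close>)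
  have 2: "Infinite_Set_Sum.abs_summable_on (\<lambda>(y, x). pmf p (x, y) * (u ^ x * v ^ y)) (UNIV \<times> UNIV)"
    using abs_summable_on_Times_swap[of ?f UNIV UNIV] 1 by simp
  have r: "Infinite_Set_Sum.abs_summable_on (\<lambda>x. pmf p (x, y) * (u ^ x * v ^ y)) UNIV" for y
    using abs_summable_on_Sigma_project2[OF 2, of y] by simp
  have col: "Infinite_Set_Sum.abs_summable_on (\<lambda>x. pmf p (x, y)) UNIV" for y
  proof -
    have "Infinite_Set_Sum.abs_summable_on (\<lambda>x. pmf p (x, y)) UNIV \<longleftrightarrow> Infinite_Set_Sum.abs_summable_on (pmf p) (range (\<lambda>x. (x, y)))"
      by (subst abs_summable_on_reindex_iff) (auto simp: inj_on_def)
    then show ?thesis using pmf_abs_summable by simp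
  qed
  have col': "summable (\<lambda>x. pmf p (x, y) * u ^ x)" for y
    by (rule summable_real_powser) (use assms col[of y] in \<open>auto simp: abs_summable_on_nat_iff'\<close>)
  then show ?T .
  have in_eq: "infsetsum (\<lambda>x. pmf p (x, y) * (u ^ x * v ^ y)) UNIV = (\<Sum>x. pmf p (x, y) * u ^ x) * v ^ y" for y
    using suminf_mult2[OF col'[of y], of "v ^ y"] infsetsum_nat'[OF r[of y]] by (simp add: mult_ac)
  have "joint_pgf p u v = infsetsum ?f UNIV"
    unfolding joint_pgf_def measure_pmf_eq_density infsetsum_def
    by (subst integral_density) (auto simp: case_prod_beta')
  also have "\<dots> = infsetsum (\<lambda>x. infsetsum (\<lambda>y. pmf p (x, y) * (u ^ x * v ^ y)) UNIV) UNIV"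
    using infsetsum_Times'[of UNIV UNIV "\<lambda>x y. pmf p (x, y) * (u ^ x * v ^ y)"] 1 by simp
  also have "\<dots> = infsetsum (\<lambda>y. infsetsum (\<lambda>x. pmf p (x, y) * (u ^ x * v ^ y)) UNIV) UNIV"
    by (rule infsetsum_swap) (use 1 in auto)
  also have "\<dots> = infsetsum (\<lambda>y. (\<Sum>x. pmf p (x, y) * u ^ x) * v ^ y) UNIV"
    by (simp add: in_eq)
  finally have e: "joint_pgf p u v = \<dots>" .
  have s: "Infinite_Set_Sum.abs_summable_on (\<lambda>y. (\<Sum>x. pmf p (x, y) * u ^ x) * v ^ y) UNIV"
    using abs_summable_on_Sigma_project1'[OF 2] by (simp add: in_eq)
  from infsetsum_nat'[OF s] e show ?E by simp
  from s show ?S by (auto simp: abs_summable_on_nat_iff' intro: summable_norm_cancel)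
qed

lemma joint_pgf_swap: "joint_pgf (map_pmf prod.swap p) v u = joint_pgf p u v"
  unfolding joint_pgf_def by (simp add: case_prod_beta' mult.commute)

text \<open>Uniqueness of coefficients is applied twice: in v for fixed u, then in u for each
  coefficient obtained.\<close>

lemma joint_pgf_unique:
  assumes "\<And>u v. 0 \<le> u \<Longrightarrow> u \<le> 1 \<Longrightarrow> 0 \<le> v \<Longrightarrow> v \<le> 1 \<Longrightarrow> joint_pgf p u v = joint_pgf p' u v"
  shows "p = p'"
proof (rule pmf_eqI)
  fix z :: "nat \<times> nat"
  obtain x y where z: "z = (x, y)" by force
  have *: "(\<Sum>x. pmf p (x, y) * u ^ x) = (\<Sum>x. pmf p' (x, y) * u ^ x)" if u: "0 \<le> u" "u \<le> 1" for u y
  proof -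
    have "(\<lambda>y. (\<Sum>x. pmf p (x, y) * u ^ x)) = (\<lambda>y. (\<Sum>x. pmf p' (x, y) * u ^ x))"
    proof (rule powser_coeff_unique[where r = 1 and s = "joint_pgf p u"])
      fix v :: real assume v: "0 < v" "v \<le> 1"
      show "(\<lambda>n. (\<Sum>x. pmf p (x, n) * u ^ x) * v ^ n) sums joint_pgf p u v"
        using joint_pgf_eq_suminf_snd(1,2)[of u v p] u v by (simp add: sums_iff)
      show "(\<lambda>n. (\<Sum>x. pmf p' (x, n) * u ^ x) * v ^ n) sums joint_pgf p u v"
        using joint_pgf_eq_suminf_snd(1,2)[of u v p'] u v assms[of u v] by (simp add: sums_iff)
    qed simp
    then show ?thesis by meson
  qed
  have "(\<lambda>x. pmf p (x, y)) = (\<lambda>x. pmf p' (x, y))"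
  proof (rule powser_coeff_unique[where r = 1 and s = "\<lambda>u. \<Sum>x. pmf p (x, y) * u ^ x"])
    fix u :: real assume u: "0 < u" "u \<le> 1"
    show "(\<lambda>n. pmf p (n, y) * u ^ n) sums (\<Sum>x. pmf p (x, y) * u ^ x)"
      using joint_pgf_eq_suminf_snd(3)[of u 1 p y] u by (simp add: sums_iff)
    show "(\<lambda>n. pmf p' (n, y) * u ^ n) sums (\<Sum>x. pmf p (x, y) * u ^ x)"
      using joint_pgf_eq_suminf_snd(3)[of u 1 p' y] u *[of u y] by (simp add: sums_iff)
  qed simp
  then show "pmf p z = pmf p' z" by (simp add: z fun_eq_iff)
qed

section \<open>Compound laws and conditional laws\<close>

lemma compound_pmf_0 [simp]: "compound_pmf Z \<epsilon> 0 = \<epsilon>"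
  by (simp add: compound_pmf_def map_snd_pair_pmf pair_return_pmf1 map_pmf_comp)

lemma compound_pmf_Suc:
  "compound_pmf Z \<epsilon> (Suc n) = map_pmf (\<lambda>(a, b). a + b) (pair_pmf Z (compound_pmf Z \<epsilon> n))"
proof -
  have 1: "{1..Suc n} = insert (Suc n) {1..n}" by auto
  have 2: "(\<Sum>i\<in>{1..n}. (f(Suc n := y)) i) = (\<Sum>i\<in>{1..n}. f i)"
    for f :: "nat \<Rightarrow> nat" and y
    by (rule sum.cong) auto
  show ?thesis
    unfolding compound_pmf_def 1
    by (subst Pi_pmf_insert)
      (auto simp: map_pmf_def pair_pmf_def bind_assoc_pmf bind_return_pmf fun_upd_same 2[unfolded One_nat_def] add_ac
         simp del: fun_upd_apply)
qed

lemma pmf_sum_pair: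
  fixes A B :: "nat pmf"
  shows "pmf (map_pmf (\<lambda>(a, b). a + b) (pair_pmf A B)) n = (\<Sum>i\<le>n. pmf A i * pmf B (n - i))"
proof -
  have v: "(\<lambda>(a, b). a + b) -` {n} = (\<lambda>i. (i, n - i)) ` {..n}" by force
  show ?thesis
    unfolding pmf_map v
    by (subst measure_measure_pmf_finite) (auto simp: sum.reindex inj_on_def pmf_pair)
qed

text \<open>The generating function as a formal object: powers and products describe compound laws,
  and their coefficients are probabilities, with no radius of convergence to track.\<close>

definition pmf_fps :: "nat pmf \<Rightarrow> real fps" where
  "pmf_fps q = Abs_fps (pmf q)"

lemma pmf_fps_nth [simp]: "fps_nth (pmf_fps q) n = pmf q n"
  by (simp add: pmf_fps_def)

lemma pmf_fps_sum_pair: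
  "pmf_fps (map_pmf (\<lambda>(a, b). a + b) (pair_pmf A B)) = pmf_fps A * pmf_fps B"
  by (simp add: fps_eq_iff fps_mult_nth pmf_sum_pair atLeast0AtMost)

lemma pmf_fps_compound: "pmf_fps (compound_pmf Z \<epsilon> n) = pmf_fps Z ^ n * pmf_fps \<epsilon>"
  by (induction n) (simp_all add: compound_pmf_Suc pmf_fps_sum_pair mult.assoc)

lemma pgf_sum_pair:
  assumes u: "0 \<le> u" "u \<le> 1"
  shows "pgf (map_pmf (\<lambda>(a, b). a + b) (pair_pmf A B)) u = pgf A u * pgf B u"
proof (rule pgf_eqI[OF pmf_sum_pair _ u])
  have s: "summable (\<lambda>n. norm (pmf q n * u ^ n))" for q :: "nat pmf"
    using pgf_sums[OF u, of q] u by (simp add: abs_mult sums_iff)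
  have "(\<lambda>k. \<Sum>i\<le>k. (pmf A i * u ^ i) * (pmf B (k - i) * u ^ (k - i))) sums
      ((\<Sum>k. pmf A k * u ^ k) * (\<Sum>k. pmf B k * u ^ k))"
    by (rule Cauchy_product_sums[OF s s])
  moreover have "(pmf A i * u ^ i) * (pmf B (k - i) * u ^ (k - i)) = pmf A i * pmf B (k - i) * u ^ k"
    if "i \<le> k" for i k
    using power_add[of u i "k - i"] that by simp
  ultimately show "(\<lambda>n. (\<Sum>i\<le>n. pmf A i * pmf B (n - i)) * u ^ n) sums (pgf A u * pgf B u)"
    using pgf_sums[OF u] by (simp add: sums_iff sum_distrib_right)
qed

lemma pgf_compound:
  assumes "0 \<le> u" "u \<le> 1"
  shows "pgf (compound_pmf Z \<epsilon> n) u = pgf Z u ^ n * pgf \<epsilon> u"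
  by (induction n) (simp_all add: compound_pmf_Suc pgf_sum_pair[OF assms] mult.assoc)

lemma expectation_sum_pair:
  fixes A B :: "nat pmf"
  assumes A: "integrable (measure_pmf A) real" and B: "integrable (measure_pmf B) real"
  shows "integrable (measure_pmf (map_pmf (\<lambda>(a, b). a + b) (pair_pmf A B))) real"
    and "measure_pmf.expectation (map_pmf (\<lambda>(a, b). a + b) (pair_pmf A B)) real
       = measure_pmf.expectation A real + measure_pmf.expectation B real"
proof -
  have 1: "integrable (measure_pmf (pair_pmf A B)) (\<lambda>z. real (fst z))"
    using A integrable_map_pmf_eq[of fst "pair_pmf A B" real] by (simp add: map_fst_pair_pmf)
  have 2: "integrable (measure_pmf (pair_pmf A B)) (\<lambda>z. real (snd z))"
    using B integrable_map_pmf_eq[of snd "pair_pmf A B" real] by (simp add: map_snd_pair_pmf)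
  show "integrable (measure_pmf (map_pmf (\<lambda>(a, b). a + b) (pair_pmf A B))) real"
    unfolding integrable_map_pmf_eq using Bochner_Integration.integrable_add[OF 1 2] by (simp add: case_prod_beta')
  show "measure_pmf.expectation (map_pmf (\<lambda>(a, b). a + b) (pair_pmf A B)) real
       = measure_pmf.expectation A real + measure_pmf.expectation B real"
    using Bochner_Integration.integral_add[OF 1 2] by (simp add: case_prod_beta')
qed

lemma expectation_compound:
  assumes Z: "integrable (measure_pmf Z) real" and e: "integrable (measure_pmf \<epsilon>) real"
  shows "integrable (measure_pmf (compound_pmf Z \<epsilon> n)) real"
    and "measure_pmf.expectation (compound_pmf Z \<epsilon> n) real
       = real n * measure_pmf.expectation Z real + measure_pmf.expectation \<epsilon> real"
proof (induction n)
  case (Suc n)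
  {
    case 1
    show ?case using expectation_sum_pair(1)[OF Z Suc(1)] by (simp add: compound_pmf_Suc)
  next
    case 2
    show ?case
      using expectation_sum_pair(2)[OF Z Suc(1)] Suc(2) by (simp add: compound_pmf_Suc algebra_simps)
  }
qed (use e in simp_all)

section \<open>Conditional laws as coefficient identities\<close>

lemma pmf_X_given_Y:
  assumes "y \<in> set_pmf (map_pmf snd p)"
  shows "pmf (X_given_Y p y) x = pmf p (x, y) / pmf (map_pmf snd p) y"
proof -
  let ?S = "{\<omega>. snd \<omega> = y}"
  have ne: "set_pmf p \<inter> ?S \<noteq> {}" using assms by force
  have "pmf (X_given_Y p y) x = measure (measure_pmf (cond_pmf p ?S)) (fst -` {x} \<inter> set_pmf (cond_pmf p ?S))"
    by (simp add: X_given_Y_def pmf_map measure_Int_set_pmf)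
  also have "fst -` {x} \<inter> set_pmf (cond_pmf p ?S) = {(x, y)} \<inter> set_pmf (cond_pmf p ?S)"
    using ne by (auto simp: set_cond_pmf)
  also have "measure (measure_pmf (cond_pmf p ?S)) \<dots> = pmf (cond_pmf p ?S) (x, y)"
    by (simp add: measure_Int_set_pmf measure_pmf_single)
  also have "\<dots> = pmf p (x, y) / measure (measure_pmf p) ?S" using ne by (simp add: pmf_cond)
  also have "?S = snd -` {y}" by auto
  finally show ?thesis by (simp add: pmf_map)
qed

text \<open>Exchanging the components lets every fact about conditioning on Y serve for conditioning
  on X.\<close>

lemma Y_given_X_eq_swap: "Y_given_X p x = X_given_Y (map_pmf prod.swap p) x"
  if "x \<in> set_pmf (map_pmf fst p)"
proof -
  have ne: "set_pmf p \<inter> prod.swap -` {\<omega>. snd \<omega> = x} \<noteq> {}" using that by force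
  have *: "prod.swap -` {\<omega>. snd \<omega> = x} = {\<omega>. fst \<omega> = x}" by auto
  have **: "fst \<circ> prod.swap = snd" by auto
  show ?thesis
    unfolding X_given_Y_def Y_given_X_def cond_map_pmf[OF ne] *
    by (simp add: pmf.map_comp **)
qed

text \<open>Multiplying by the marginal probability turns the conditional statement into one for all
  pairs: where the conditioning event is null, both sides are 0. One half is proved for an arbitrary
  law and then applied to the swapped one.\<close>

lemma bivariate_car_iff:
  "bivariate_car p Z \<epsilon> W \<eta> \<longleftrightarrow>
     (\<forall>x y. pmf p (x, y) = pmf (map_pmf snd p) y * fps_nth (pmf_fps Z ^ y * pmf_fps \<epsilon>) x) \<and>
     (\<forall>x y. pmf p (x, y) = pmf (map_pmf fst p) x * fps_nth (pmf_fps W ^ x * pmf_fps \<eta>) y)"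
proof -
  have *: "(\<forall>y\<in>set_pmf (map_pmf snd p). X_given_Y p y = compound_pmf Z \<epsilon> y) \<longleftrightarrow>
     (\<forall>x y. pmf p (x, y) = pmf (map_pmf snd p) y * fps_nth (pmf_fps Z ^ y * pmf_fps \<epsilon>) x)"
    for p :: "(nat \<times> nat) pmf" and Z \<epsilon>
  proof -
    have "X_given_Y p y = compound_pmf Z \<epsilon> y \<longleftrightarrow>
        (\<forall>x. pmf p (x, y) = pmf (map_pmf snd p) y * fps_nth (pmf_fps Z ^ y * pmf_fps \<epsilon>) x)"
      if "y \<in> set_pmf (map_pmf snd p)" for y
    proof -
      have "pmf (map_pmf snd p) y \<noteq> 0" using that by (simp add: pmf_eq_0_set_pmf del: set_map_pmf)
      then show ?thesis
        unfolding pmf_fps_compound[symmetric] pmf_eq_iff pmf_X_given_Y[OF that]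
        by (auto simp: field_simps)
    qed
    moreover have "(\<forall>x. pmf p (x, y) = pmf (map_pmf snd p) y * fps_nth (pmf_fps Z ^ y * pmf_fps \<epsilon>) x)"
      if "y \<notin> set_pmf (map_pmf snd p)" for y
    proof -
      have "(x, y) \<notin> set_pmf p" for x using that by force
      then show ?thesis using that by (simp add: pmf_eq_0_set_pmf[THEN iffD2] del: set_map_pmf)
    qed
    ultimately show ?thesis by metis
  qed
  have 1: "map_pmf snd (map_pmf prod.swap p) = map_pmf fst p" by (simp add: pmf.map_comp comp_def)
  have 2: "pmf (map_pmf prod.swap p) (y, x) = pmf p (x, y)" for x y
    using pmf_map_inj'[of prod.swap p "(x, y)"] by simp
  show ?thesis
    unfolding bivariate_car_def * 
    using *[of "map_pmf prod.swap p" W \<eta>] Y_given_X_eq_swap[of _ p]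
    unfolding 1 2 by (metis (no_types, lifting))
qed

text \<open>Comparing total masses forces \<open>K = 1\<close>; this spares computing normalizing
  constants.\<close>

lemma proportional_pmf_eq:
  assumes "\<And>z. pmf p z = K * pmf p' z"
  shows "p = p'"
proof -
  have "infsetsum (pmf p) UNIV = K * infsetsum (pmf p') UNIV"
    unfolding assms by (rule infsetsum_cmult_right) (rule pmf_abs_summable)
  then have "K = 1" by (simp add: infsetsum_pmf_eq_1)
  with assms show ?thesis by (intro pmf_eqI) simp
qed

text \<open>Full support is what makes the two families of conditional laws determine the joint law.\<close>

lemma regular_bivariate_car_unique:
  assumes "regular_bivariate_car p Z \<epsilon> W \<eta>" "regular_bivariate_car p' Z \<epsilon> W \<eta>"
  shows "p = p'"
proof -
  define F where "F x y = fps_nth (pmf_fps Z ^ y * pmf_fps \<epsilon>) x" for x y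
  define H where "H x y = fps_nth (pmf_fps W ^ x * pmf_fps \<eta>) y" for x y
  \<comment> \<open>The two expressions for the cell (x, 0) express the marginal of X through that
    of Y at 0. Hence every cell is known up to this single factor.\<close>
  have gen: "pmf q (x, y) = pmf (map_pmf snd q) 0 * (F x 0 / H x 0 * H x y) \<and> pmf (map_pmf snd q) 0 \<noteq> 0"
    if "regular_bivariate_car q Z \<epsilon> W \<eta>" for q x y
  proof -
    have 1: "pmf q (x, y) = pmf (map_pmf snd q) y * F x y" "pmf q (x, y) = pmf (map_pmf fst q) x * H x y" for x y
      using that unfolding regular_bivariate_car_def bivariate_car_iff F_def H_def by blast+
    have 2: "pmf q (x, y) \<noteq> 0" for x y
      using that by (simp add: regular_bivariate_car_def pmf_eq_0_set_pmf)
    have 3: "pmf (map_pmf snd q) 0 \<noteq> 0" "H x 0 \<noteq> 0" using 1 2 by (metis mult_eq_0_iff)+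
    have "pmf (map_pmf fst q) x = pmf (map_pmf snd q) 0 * F x 0 / H x 0"
      using 1[of x 0] 3 by (simp add: field_simps)
    then show ?thesis using 1(2)[of x y] 3 by simp
  qed
  let ?K = "pmf (map_pmf snd p) 0 / pmf (map_pmf snd p') 0"
  show ?thesis
  proof (rule proportional_pmf_eq[of _ ?K])
    fix z :: "nat \<times> nat"
    obtain x y where z: "z = (x, y)" by force
    have "pmf p (x, y) = pmf (map_pmf snd p) 0 * (F x 0 / H x 0 * H x y)"
      and "pmf p' (x, y) = pmf (map_pmf snd p') 0 * (F x 0 / H x 0 * H x y)"
      and "pmf (map_pmf snd p') 0 \<noteq> 0"
      using gen[OF assms(1)] gen[OF assms(2)] by blast+
    then show "pmf p z = ?K * pmf p' z" by (simp add: z)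
  qed
qed

section \<open>Poisson, negative binomial and linear fractional laws\<close>

text \<open>Ratio test: the factor n^k contributes (\<open>Suc n\<close> / n)^k, which tends to 1,
  so a ratio bounded away from 1 survives it.\<close>

lemma finite_momentsI:
  assumes "c < 1" and ev: "eventually (\<lambda>n. pmf q (Suc n) \<le> c * pmf q n) sequentially"
  shows "finite_moments q"
  unfolding finite_moments_def
proof
  fix k
  define c' where "c' = max c 0"
  obtain r where r: "c' < r" "r < 1" using dense[of c' 1] \<open>c < 1\<close> by (auto simp: c'_def)
  have "(\<lambda>n. c' * (real (Suc n) / real n) ^ k) \<longlonglongrightarrow> c' * 1 ^ k"
    by (intro tendsto_intros LIMSEQ_Suc_n_over_n)
  then have "eventually (\<lambda>n. c' * (real (Suc n) / real n) ^ k < r) sequentially"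
    using r(1) by (intro order_tendstoD(2)) auto
  from eventually_conj[OF this eventually_conj[OF ev eventually_gt_at_top[of 0]]]
  obtain N where N: "\<And>n. n \<ge> N \<Longrightarrow> c' * (real (Suc n) / real n) ^ k < r \<and> pmf q (Suc n) \<le> c * pmf q n \<and> 0 < n"
    unfolding eventually_sequentially by blast
  have "summable (\<lambda>n. pmf q n * real n ^ k)"
  proof (rule summable_ratio_test[OF r(2)])
    fix n assume "n \<ge> N"
    note N = N[OF this]
    have "pmf q (Suc n) \<le> c' * pmf q n"
      using N mult_right_mono[of c c' "pmf q n"] by (auto simp: c'_def)
    then have "pmf q (Suc n) * real (Suc n) ^ k \<le> c' * pmf q n * real (Suc n) ^ k"
      by (intro mult_right_mono) auto
    also have "\<dots> = (c' * (real (Suc n) / real n) ^ k) * (pmf q n * real n ^ k)"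
      using N by (simp add: power_divide)
    also have "\<dots> \<le> r * (pmf q n * real n ^ k)"
      using N by (intro mult_right_mono) auto
    finally show "norm (pmf q (Suc n) * real (Suc n) ^ k) \<le> r * norm (pmf q n * real n ^ k)"
      by (simp add: abs_mult)
  qed
  then show "integrable (measure_pmf q) (\<lambda>n. real n ^ k)"
    by (simp add: integrable_pmf_nat_iff abs_mult)
qed

lemma finite_moments_integrable: "finite_moments q \<Longrightarrow> integrable (measure_pmf q) real"
  unfolding finite_moments_def by (auto dest: spec[of _ 1])

text \<open>Panjer's recursion unites the Poisson (\<open>c = 0\<close>) and the negative binomial laws (\<open>0 < c < 1\<close>).\<close>

definition panjer :: "real \<Rightarrow> real \<Rightarrow> nat pmf \<Rightarrow> bool" where
  "panjer a c q \<longleftrightarrow> (\<forall>n. real (Suc n) * pmf q (Suc n) = (a + c * real n) * pmf q n)"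

text \<open>Successive probabilities have a ratio tending to \<open>c\<close>, so the midpoint of
  \<open>c\<close> and 1 is eventually an upper bound.\<close>

lemma panjer_finite_moments:
  assumes "panjer a c q" "0 \<le> c" "c < 1"
  shows "finite_moments q"
proof (rule finite_momentsI)
  show "(1 + c) / 2 < 1" using assms by simp
  have "(\<lambda>n. (a + c * real n) / real (Suc n)) \<longlonglongrightarrow> c" by real_asymp
  then have "eventually (\<lambda>n. (a + c * real n) / real (Suc n) < (1 + c) / 2) sequentially"
    using assms by (intro order_tendstoD(2)) auto
  then show "eventually (\<lambda>n. pmf q (Suc n) \<le> (1 + c) / 2 * pmf q n) sequentially"
  proof eventually_elim
    case (elim n)
    have "pmf q (Suc n) = (a + c * real n) / real (Suc n) * pmf q n"
      using assms(1) unfolding panjer_def by (metis nonzero_mult_div_cancel_left of_nat_neq_0 times_divide_eq_left)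
    also have "\<dots> \<le> (1 + c) / 2 * pmf q n"
      by (rule mult_right_mono) (use elim in auto)
    finally show ?case .
  qed
qed

text \<open>A first-order recursion fixes a law up to its value at 0, and normalization fixes that
  value.\<close>

lemma panjer_eq:
  assumes "panjer a c q" "panjer a c q'" "pmf q' 0 \<noteq> 0"
  shows "q = q'"
proof (rule proportional_pmf_eq)
  fix n
  show "pmf q n = (pmf q 0 / pmf q' 0) * pmf q' n"
  proof (induction n)
    case (Suc n)
    have "real (Suc n) * pmf q (Suc n) = real (Suc n) * ((pmf q 0 / pmf q' 0) * pmf q' (Suc n))"
      using assms(1,2) Suc unfolding panjer_def by (simp add: mult.left_commute[of "real (Suc n)"] del: of_nat_Suc)
    then show ?case by (metis mult_left_cancel of_nat_neq_0)
  qed (use assms(3) in simp)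
qed

lemma panjer_poisson: "0 < l \<Longrightarrow> panjer l 0 (poisson_pmf l)"
  by (simp add: panjer_def fact_Suc del: of_nat_Suc)

lemma pgf_poisson:
  assumes "0 < l" "0 \<le> u" "u \<le> 1"
  shows "pgf (poisson_pmf l) u = exp (- (l * (1 - u)))"
proof (rule pgf_eqI[OF pmf_poisson _ assms(2,3)])
  show "(\<lambda>n. l ^ n / fact n * exp (- l) * u ^ n) sums exp (- (l * (1 - u)))"
  proof -
    have "exp (- l) * exp (l * u) = exp (- (l * (1 - u)))"
      unfolding exp_add[symmetric] by (simp add: algebra_simps)
    moreover have "exp (- l) * ((l * u) ^ n /\<^sub>R fact n) = l ^ n / fact n * exp (- l) * u ^ n" for n
      by (simp add: power_mult_distrib divide_inverse)
    ultimately show ?thesis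
      using sums_mult[OF exp_converges[of "l * u"], of "exp (- l)"] by (simp only:)
  qed
qed (use assms in simp_all)

section \<open>Negative binomial laws with real shape\<close>

text \<open>Newton's binomial series with exponent -\<delta> at -x; the sign of the binomial
  coefficient cancels that of the power.\<close>

lemma pochhammer_sums:
  fixes x \<delta> :: real
  assumes "\<bar>x\<bar> < 1"
  shows "(\<lambda>n. pochhammer \<delta> n / fact n * x ^ n) sums (1 - x) powr (- \<delta>)"
proof -
  have "(\<lambda>n. (- \<delta> gchoose n) * (- x) ^ n) sums (1 + (- x)) powr (- \<delta>)"
    by (rule gen_binomial_real) (use assms in simp)
  moreover have "(- \<delta> gchoose n) * (- x) ^ n = pochhammer \<delta> n / fact n * x ^ n" for n
  proof -
    have "(- \<delta> gchoose n) * (- x) ^ n = ((- 1) ^ n * (- 1) ^ n) * (pochhammer \<delta> n / fact n * x ^ n)"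
      unfolding gbinomial_pochhammer power_minus[of x] by simp
    also have "(- 1) ^ n * (- 1) ^ n = (1 :: real)" by (simp flip: power_mult_distrib)
    finally show ?thesis by simp
  qed
  ultimately show ?thesis by simp
qed

text \<open>The negative binomial law with real shape \<delta>, success probability 1/(1 + \<theta>)
  and mean \<delta> * \<theta>.\<close>

definition neg_binomial_real_pmf :: "real \<Rightarrow> real \<Rightarrow> nat pmf" where
  "neg_binomial_real_pmf \<delta> \<theta> =
     embed_pmf (\<lambda>n. pochhammer \<delta> n / fact n * (\<theta> / (1 + \<theta>)) ^ n * (1 + \<theta>) powr (- \<delta>))"

text \<open>For x = \<theta> u / (1 + \<theta>) one has 1 - x = (1 + \<theta> (1 - u)) / (1 +
  \<theta>), so the normalizing power of 1 + \<theta> cancels in the binomial series.\<close>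

lemma neg_binomial_real_sums:
  fixes \<delta> \<theta> u :: real
  assumes "\<theta> > 0" "0 \<le> u" "u \<le> 1"
  shows "(\<lambda>n. pochhammer \<delta> n / fact n * (\<theta> / (1 + \<theta>)) ^ n * (1 + \<theta>) powr (- \<delta>) * u ^ n)
           sums (1 / (1 + \<theta> * (1 - u)) powr \<delta>)"
proof -
  let ?x = "\<theta> / (1 + \<theta>) * u"
  have x: "0 \<le> ?x" "?x < 1"
    using assms le_less_trans[OF mult_left_le[of u \<theta>], of "1 + \<theta>"] by (auto simp: pos_divide_less_eq)
  have "1 - ?x = (1 + \<theta> * (1 - u)) / (1 + \<theta>)" using assms by (simp add: field_simps)
  then have e: "(1 - ?x) powr (- \<delta>) * (1 + \<theta>) powr (- \<delta>) = 1 / (1 + \<theta> * (1 - u)) powr \<delta>"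
    using assms by (simp only: powr_divide powr_minus_divide) simp
  have "(\<lambda>n. pochhammer \<delta> n / fact n * ?x ^ n) sums (1 - ?x) powr (- \<delta>)"
    using x by (intro pochhammer_sums) linarith
  from sums_mult2[OF this, of "(1 + \<theta>) powr (- \<delta>)"] have
    "(\<lambda>n. pochhammer \<delta> n / fact n * ?x ^ n * (1 + \<theta>) powr (- \<delta>)) sums (1 / (1 + \<theta> * (1 - u)) powr \<delta>)"
    unfolding e .
  moreover have "P * (q * u) ^ n * K = P * q ^ n * K * u ^ n" for P q K :: real and n
    by (simp add: power_mult_distrib)
  ultimately show ?thesis by (simp only:)
qed

lemma pmf_neg_binomial_real:
  assumes "\<theta> > 0" "\<delta> > 0"
  shows "pmf (neg_binomial_real_pmf \<delta> \<theta>) n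
       = pochhammer \<delta> n / fact n * (\<theta> / (1 + \<theta>)) ^ n * (1 + \<theta>) powr (- \<delta>)"
  unfolding neg_binomial_real_pmf_def
proof (rule pmf_embed_pmf)
  let ?a = "\<lambda>n. pochhammer \<delta> n / fact n * (\<theta> / (1 + \<theta>)) ^ n * (1 + \<theta>) powr (- \<delta>)"
  show nn: "?a n \<ge> 0" for n
    using assms by (simp add: pochhammer_nonneg)
  have "?a sums 1" using neg_binomial_real_sums[of \<theta> 1 \<delta>] assms(1) by (simp only: power_one mult_1_right diff_self) simp
  then have "(\<Sum>n. ennreal (?a n)) = ennreal 1" by (rule suminf_ennreal_eq[OF nn])
  then show "(\<integral>\<^sup>+ x. ennreal (?a x) \<partial>count_space UNIV) = 1"
    by (simp only: nn_integral_count_space_nat ennreal_1)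
qed

lemma pmf_neg_binomial_real_pos:
  "\<theta> > 0 \<Longrightarrow> \<delta> > 0 \<Longrightarrow> 0 < pmf (neg_binomial_real_pmf \<delta> \<theta>) n"
  unfolding pmf_neg_binomial_real
  by (intro mult_pos_pos divide_pos_pos pochhammer_pos zero_less_power) (simp_all add: add_pos_pos)

lemma pgf_neg_binomial_real:
  assumes "\<theta> > 0" "\<delta> > 0" "0 \<le> u" "u \<le> 1"
  shows "pgf (neg_binomial_real_pmf \<delta> \<theta>) u = 1 / (1 + \<theta> * (1 - u)) powr \<delta>"
  by (rule pgf_eqI[OF pmf_neg_binomial_real neg_binomial_real_sums]) (use assms in auto)

lemma neg_binomial_real_eqI:
  assumes "\<theta> > 0" "\<delta> > 0" "\<And>u. 0 \<le> u \<Longrightarrow> u \<le> 1 \<Longrightarrow> pgf q u = 1 / (1 + \<theta> * (1 - u)) powr \<delta>"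
  shows "q = neg_binomial_real_pmf \<delta> \<theta>"
proof (rule pmf_eqI)
  fix n
  have "pmf q = (\<lambda>n. pochhammer \<delta> n / fact n * (\<theta> / (1 + \<theta>)) ^ n * (1 + \<theta>) powr (- \<delta>))"
  proof (rule pmf_nat_eqI_pgf)
    fix u :: real assume u: "0 < u" "u \<le> 1"
    show "(\<lambda>n. pochhammer \<delta> n / fact n * (\<theta> / (1 + \<theta>)) ^ n * (1 + \<theta>) powr (- \<delta>) * u ^ n) sums pgf q u"
      unfolding assms(3)[OF less_imp_le[OF u(1)] u(2)] by (rule neg_binomial_real_sums) (use assms u in simp_all)
  qed
  then show "pmf q n = pmf (neg_binomial_real_pmf \<delta> \<theta>) n" using assms by (simp add: pmf_neg_binomial_real)
qed

lemma panjer_neg_binomial_real: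
  assumes "\<theta> > 0" "\<delta> > 0"
  shows "panjer (\<theta> / (1 + \<theta>) * \<delta>) (\<theta> / (1 + \<theta>)) (neg_binomial_real_pmf \<delta> \<theta>)"
  unfolding panjer_def pmf_neg_binomial_real[OF assms]
proof
  fix n
  have *: "N * (P * (\<delta> + m) / (N * F) * (c * C) * K) = (c * \<delta> + c * m) * (P / F * C * K)"
    if "N \<noteq> 0" for N m F P c C K :: real
  proof -
    have "N * (P * (\<delta> + m) / (N * F) * (c * C) * K) = (N / N) * (P * (\<delta> + m) / F * (c * C) * K)" by simp
    then show ?thesis using that by (simp add: algebra_simps)
  qed
  show "real (Suc n) * (pochhammer \<delta> (Suc n) / fact (Suc n) * (\<theta> / (1 + \<theta>)) ^ Suc n * (1 + \<theta>) powr (- \<delta>)) =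
    (\<theta> / (1 + \<theta>) * \<delta> + \<theta> / (1 + \<theta>) * real n) *
    (pochhammer \<delta> n / fact n * (\<theta> / (1 + \<theta>)) ^ n * (1 + \<theta>) powr (- \<delta>))"
    unfolding pochhammer_Suc power_Suc fact_Suc by (rule *) simp
qed

lemma finite_moments_neg_binomial_real:
  "\<theta> > 0 \<Longrightarrow> \<delta> > 0 \<Longrightarrow> finite_moments (neg_binomial_real_pmf \<delta> \<theta>)"
  by (rule panjer_finite_moments[OF panjer_neg_binomial_real]) auto

lemma finite_moments_poisson: "0 < l \<Longrightarrow> finite_moments (poisson_pmf l)"
  by (rule panjer_finite_moments[OF panjer_poisson]) auto

section \<open>Linear fractional laws\<close>

text \<open>Partial fractions in 1 - u: the constant
  \<open>\<theta>\<^sub>2 / \<theta>\<^sub>1\<close> contributes only to the coefficient at 0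
  (possibly negatively), and the remainder is a geometric series.\<close>

lemma linear_fractional_sums:
  fixes \<theta>\<^sub>1 \<theta>\<^sub>2 u :: real
  assumes "\<theta>\<^sub>1 > 0" "0 \<le> u" "u \<le> 1"
  shows "(\<lambda>n. ((if n = 0 then \<theta>\<^sub>2 / \<theta>\<^sub>1 else 0) + (\<theta>\<^sub>1 - \<theta>\<^sub>2) / (\<theta>\<^sub>1 * (1 + \<theta>\<^sub>1)) * (\<theta>\<^sub>1 / (1 + \<theta>\<^sub>1)) ^ n) * u ^ n)
           sums ((1 + \<theta>\<^sub>2 * (1 - u)) / (1 + \<theta>\<^sub>1 * (1 - u)))"
proof -
  let ?x = "\<theta>\<^sub>1 / (1 + \<theta>\<^sub>1) * u"
  let ?L = "(\<theta>\<^sub>1 - \<theta>\<^sub>2) / (\<theta>\<^sub>1 * (1 + \<theta>\<^sub>1))"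
  have x: "0 \<le> ?x" "?x < 1"
    using assms le_less_trans[OF mult_left_le[of u \<theta>\<^sub>1], of "1 + \<theta>\<^sub>1"] by (auto simp: pos_divide_less_eq)
  then have x': "norm ?x < 1" unfolding real_norm_def by linarith
  have d: "1 + \<theta>\<^sub>1 * (1 - u) > 0" using assms by (intro add_pos_nonneg) auto
  have "(\<lambda>n. (if n = 0 then \<theta>\<^sub>2 / \<theta>\<^sub>1 else 0) + ?L * ?x ^ n) sums (\<theta>\<^sub>2 / \<theta>\<^sub>1 + ?L * (1 / (1 - ?x)))"
    using sums_add[OF sums_single[of 0 "\<lambda>_. \<theta>\<^sub>2 / \<theta>\<^sub>1"] sums_mult[OF geometric_sums[OF x'], of ?L]] by simp
  moreover have "\<theta>\<^sub>2 / \<theta>\<^sub>1 + ?L * (1 / (1 - ?x)) = (1 + \<theta>\<^sub>2 * (1 - u)) / (1 + \<theta>\<^sub>1 * (1 - u))"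
  proof -
    have "1 - ?x = (1 + \<theta>\<^sub>1 * (1 - u)) / (1 + \<theta>\<^sub>1)" using assms by (simp add: field_simps)
    then have e: "?L * (1 / (1 - ?x)) = (\<theta>\<^sub>1 - \<theta>\<^sub>2) / (\<theta>\<^sub>1 * (1 + \<theta>\<^sub>1 * (1 - u)))" using assms by simp
    moreover have "\<theta>\<^sub>2 / \<theta>\<^sub>1 + (\<theta>\<^sub>1 - \<theta>\<^sub>2) / (\<theta>\<^sub>1 * t) = (1 + \<theta>\<^sub>2 * (1 - u)) / t"
      if "t = 1 + \<theta>\<^sub>1 * (1 - u)" "t > 0" for t
      using assms that(2) by (simp add: field_simps) (simp add: that(1) algebra_simps)
    ultimately show ?thesis unfolding e using d by blast
  qed
  moreover have "((if n = 0 then a else 0) + L * q ^ n) * u ^ n = (if n = 0 then a else 0) + L * (q * u) ^ n"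
    for n :: nat and a L q :: real
    by (cases n) (simp_all add: power_mult_distrib)
  ultimately show ?thesis by (simp only:)
qed

lemma linear_fractional_pmf:
  assumes "\<theta>\<^sub>1 > 0" and "\<And>u. 0 \<le> u \<Longrightarrow> u \<le> 1 \<Longrightarrow> pgf q u = (1 + \<theta>\<^sub>2 * (1 - u)) / (1 + \<theta>\<^sub>1 * (1 - u))"
  shows "pmf q = (\<lambda>n. (if n = 0 then \<theta>\<^sub>2 / \<theta>\<^sub>1 else 0) + (\<theta>\<^sub>1 - \<theta>\<^sub>2) / (\<theta>\<^sub>1 * (1 + \<theta>\<^sub>1)) * (\<theta>\<^sub>1 / (1 + \<theta>\<^sub>1)) ^ n)"
proof (rule pmf_nat_eqI_pgf)
  fix u :: real assume u: "0 < u" "u \<le> 1"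
  show "(\<lambda>n. ((if n = 0 then \<theta>\<^sub>2 / \<theta>\<^sub>1 else 0) + (\<theta>\<^sub>1 - \<theta>\<^sub>2) / (\<theta>\<^sub>1 * (1 + \<theta>\<^sub>1)) * (\<theta>\<^sub>1 / (1 + \<theta>\<^sub>1)) ^ n) * u ^ n) sums pgf q u"
    unfolding assms(2)[OF less_imp_le[OF u(1)] u(2)] by (rule linear_fractional_sums) (use assms u in simp_all)
qed

lemma finite_moments_linear_fractional:
  assumes "\<theta>\<^sub>1 > 0" and "\<And>u. 0 \<le> u \<Longrightarrow> u \<le> 1 \<Longrightarrow> pgf q u = (1 + \<theta>\<^sub>2 * (1 - u)) / (1 + \<theta>\<^sub>1 * (1 - u))"
  shows "finite_moments q"
proof (rule finite_momentsI)
  show "\<theta>\<^sub>1 / (1 + \<theta>\<^sub>1) < 1" using assms by simp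
  show "eventually (\<lambda>n. pmf q (Suc n) \<le> \<theta>\<^sub>1 / (1 + \<theta>\<^sub>1) * pmf q n) sequentially"
    using eventually_gt_at_top[of 0]
    by eventually_elim (simp add: linear_fractional_pmf[OF assms])
qed

section \<open>Expectations from generating functions\<close>

text \<open>Difference quotients at 1 are taken from the left, where \<open>pgf q\<close> agrees
  with \<open>F\<close>. Bernoulli's inequality bounds the quotient of u^n by n, so dominated
  convergence applies with the integrable function \<open>real\<close>.\<close>

lemma expectation_from_pgf:
  assumes int: "integrable (measure_pmf q) real"
    and pgf: "\<And>u. 0 \<le> u \<Longrightarrow> u \<le> 1 \<Longrightarrow> pgf q u = F u"
    and D: "(F has_real_derivative D) (at 1)"
  shows "measure_pmf.expectation q real = D"
proof -
  \<comment> \<open>The increments are negative and at least -1, so 1 + \<open>h m\<close> stays in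
    [0,1).\<close>
  define h where "h m = - (1 / real (Suc m))" for m
  have h: "h \<longlonglongrightarrow> 0" "\<And>m. h m \<noteq> 0" "\<And>m. -1 \<le> h m" "\<And>m. h m < 0"
    unfolding h_def using tendsto_minus[OF LIMSEQ_inverse_real_of_nat] by (auto simp: inverse_eq_divide)
  then have at0: "filterlim h (at 0) sequentially"
    by (simp add: filterlim_at)
  have lim: "(\<lambda>m. ((1 + h m) ^ n - 1) / h m) \<longlonglongrightarrow> real n" for n
  proof -
    have "((\<lambda>u::real. u ^ n) has_real_derivative real n) (at 1)"
      by (auto intro!: derivative_eq_intros)
    then have "((\<lambda>h::real. ((1 + h) ^ n - 1 ^ n) / h) \<longlongrightarrow> real n) (at 0)"
      by (simp add: DERIV_def)
    from filterlim_compose[OF this at0] show ?thesis by simp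
  qed
  have l: "(\<lambda>m. measure_pmf.expectation q (\<lambda>n. ((1 + h m) ^ n - 1) / h m)) \<longlonglongrightarrow> measure_pmf.expectation q real"
  proof (rule integral_dominated_convergence[where w = real])
    show "AE n in measure_pmf q. norm (((1 + h m) ^ n - 1) / h m) \<le> real n" for m
    proof (rule AE_I2)
      fix n
      have "1 + real n * h m \<le> (1 + h m) ^ n" by (rule Bernoulli_inequality) (rule h)
      moreover have "(1 + h m) ^ n \<le> 1" using h(3,4)[of m] by (intro power_le_one) auto
      ultimately show "norm (((1 + h m) ^ n - 1) / h m) \<le> real n"
        using h(4)[of m] by (simp add: abs_if field_simps)
    qed
  qed (use int lim in auto)
  have e: "measure_pmf.expectation q (\<lambda>n. ((1 + h m) ^ n - 1) / h m) = (F (1 + h m) - F 1) / h m" for m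
  proof -
    have 1: "integrable (measure_pmf q) (\<lambda>n. (1 + h m) ^ n)"
      by (rule integrable_pgf) (use h(3,4)[of m] in auto)
    have "measure_pmf.expectation q (\<lambda>n. ((1 + h m) ^ n - 1) / h m) = (pgf q (1 + h m) - 1) / h m"
      unfolding pgf_def using 1 by simp
    moreover have "pgf q 1 = 1" by (simp add: pgf_def)
    ultimately show ?thesis using pgf[of "1 + h m"] pgf[of 1] h(3,4)[of m] by simp
  qed
  have "(\<lambda>m. (F (1 + h m) - F 1) / h m) \<longlonglongrightarrow> D"
    by (rule filterlim_compose[OF _ at0]) (use D in \<open>simp add: DERIV_def\<close>)
  then show ?thesis using l unfolding e by (rule LIMSEQ_unique[symmetric])
qed

lemma expectation_poisson:
  assumes "0 < l"
  shows "measure_pmf.expectation (poisson_pmf l) real = l"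
proof (rule expectation_from_pgf[OF finite_moments_integrable[OF finite_moments_poisson[OF assms]]])
  show "((\<lambda>u. exp (- (l * (1 - u)))) has_real_derivative l) (at 1)"
    by (auto intro!: derivative_eq_intros)
qed (use assms pgf_poisson in auto)

lemma expectation_neg_binomial_real:
  assumes "\<theta> > 0" "\<delta> > 0"
  shows "measure_pmf.expectation (neg_binomial_real_pmf \<delta> \<theta>) real = \<delta> * \<theta>"
proof (rule expectation_from_pgf[OF finite_moments_integrable[OF finite_moments_neg_binomial_real[OF assms]]])
  show "((\<lambda>u. 1 / (1 + \<theta> * (1 - u)) powr \<delta>) has_real_derivative \<delta> * \<theta>) (at 1)"
    by (auto intro!: derivative_eq_intros)
qed (use assms pgf_neg_binomial_real in auto)

lemma expectation_linear_fractional: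
  assumes "\<theta>\<^sub>1 > 0" and "\<And>u. 0 \<le> u \<Longrightarrow> u \<le> 1 \<Longrightarrow> pgf q u = (1 + \<theta>\<^sub>2 * (1 - u)) / (1 + \<theta>\<^sub>1 * (1 - u))"
  shows "measure_pmf.expectation q real = \<theta>\<^sub>1 - \<theta>\<^sub>2"
proof (rule expectation_from_pgf[OF finite_moments_integrable[OF finite_moments_linear_fractional[OF assms]]])
  show "((\<lambda>u. (1 + \<theta>\<^sub>2 * (1 - u)) / (1 + \<theta>\<^sub>1 * (1 - u))) has_real_derivative \<theta>\<^sub>1 - \<theta>\<^sub>2) (at 1)"
    by (auto intro!: derivative_eq_intros)
qed (use assms in auto)

section \<open>Existence of the joint law\<close>

definition joint_of :: "nat pmf \<Rightarrow> (nat \<Rightarrow> nat pmf) \<Rightarrow> (nat \<times> nat) pmf" where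
  "joint_of P Q = bind_pmf P (\<lambda>y. map_pmf (\<lambda>x. (x, y)) (Q y))"

lemma pmf_joint_of: "pmf (joint_of P Q) (x, y) = pmf P y * pmf (Q y) x"
proof -
  have *: "pmf (map_pmf (\<lambda>x. (x, y')) (Q y')) (x, y) = (if y' = y then pmf (Q y) x else 0)" for y'
  proof -
    have "(\<lambda>x. (x, y')) -` {(x, y)} = (if y' = y then {x} else {})" by auto
    then show ?thesis by (simp add: pmf_map measure_pmf_single)
  qed
  show ?thesis
    unfolding joint_of_def pmf_bind *
    by (subst integral_measure_pmf[of "{y}"]) (auto split: if_splits)
qed

lemma map_snd_joint_of: "map_pmf snd (joint_of P Q) = P"
  by (simp add: joint_of_def map_bind_pmf pmf.map_comp comp_def map_pmf_const bind_return_pmf')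

text \<open>Summing over x gives f(u)^y g(u); together with v^y this evaluates the generating
  function of \<open>P\<close> at v f(u), again a point of [0,1].\<close>

lemma joint_pgf_joint_of:
  assumes uv: "0 \<le> u" "u \<le> 1" "0 \<le> v" "v \<le> 1"
  shows "joint_pgf (joint_of P (compound_pmf Z \<epsilon>)) u v = pgf P (v * pgf Z u) * pgf \<epsilon> u"
proof -
  have 1: "0 \<le> v * pgf Z u" "v * pgf Z u \<le> 1"
    using uv pgf_nonneg[of u Z] pgf_le_1[of u Z] by (auto intro: mult_le_one)
  have "(\<Sum>x. pmf (joint_of P (compound_pmf Z \<epsilon>)) (x, y) * u ^ x) = pmf P y * (pgf Z u ^ y * pgf \<epsilon> u)" for y
    using sums_mult[OF pgf_sums[OF uv(1,2), of "compound_pmf Z \<epsilon> y"], of "pmf P y"]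
    by (simp add: pmf_joint_of pgf_compound[OF uv(1,2)] sums_iff mult.assoc)
  then have "joint_pgf (joint_of P (compound_pmf Z \<epsilon>)) u v = (\<Sum>y. pmf P y * (v * pgf Z u) ^ y * pgf \<epsilon> u)"
    using joint_pgf_eq_suminf_snd(2)[OF uv, of "joint_of P (compound_pmf Z \<epsilon>)"]
    by (simp add: power_mult_distrib mult_ac)
  also have "\<dots> = pgf P (v * pgf Z u) * pgf \<epsilon> u"
    using sums_mult2[OF pgf_sums[OF 1, of P], of "pgf \<epsilon> u"] by (simp add: sums_iff)
  finally show ?thesis .
qed

text \<open>The event that all summands vanish and the innovation supplies x already has positive
  probability.\<close>

lemma pmf_compound_pos:
  assumes "0 < pmf Z 0" "\<And>n. 0 < pmf \<epsilon> n"
  shows "0 < pmf (compound_pmf Z \<epsilon> y) x"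
proof (induction y)
  case (Suc y)
  have "0 < pmf Z 0 * pmf (compound_pmf Z \<epsilon> y) (x - 0)" using assms Suc by simp
  also have "\<dots> \<le> (\<Sum>i\<le>x. pmf Z i * pmf (compound_pmf Z \<epsilon> y) (x - i))"
    by (rule member_le_sum) auto
  finally show ?case by (simp add: compound_pmf_Suc pmf_sum_pair)
qed (use assms in simp)

text \<open>The joint laws built from the two families of conditional laws have the same generating function
  exactly when \<open>G\<^sub>Y (v f(u)) g(u) = G\<^sub>X (u h(v)) k(v)\<close>.\<close>

lemma regular_bivariate_carI:
  assumes eq: "\<And>u v. 0 \<le> u \<Longrightarrow> u \<le> 1 \<Longrightarrow> 0 \<le> v \<Longrightarrow> v \<le> 1 \<Longrightarrow>
      pgf PY (v * pgf Z u) * pgf \<epsilon> u = pgf PX (u * pgf W v) * pgf \<eta> v"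
    and pos: "0 < pmf Z 0" "\<And>n. 0 < pmf \<epsilon> n" "\<And>n. 0 < pmf PY n"
    and mom: "finite_moments PX" "finite_moments PY" "finite_moments Z" "finite_moments \<epsilon>"
      "finite_moments W" "finite_moments \<eta>"
  obtains p where "regular_bivariate_car p Z \<epsilon> W \<eta>" "map_pmf fst p = PX" "map_pmf snd p = PY"
    "p = joint_of PY (compound_pmf Z \<epsilon>)"
proof -
  define p where "p = joint_of PY (compound_pmf Z \<epsilon>)"
  have p_eq: "p = map_pmf prod.swap (joint_of PX (compound_pmf W \<eta>))"
  proof (rule joint_pgf_unique)
    fix u v :: real assume uv: "0 \<le> u" "u \<le> 1" "0 \<le> v" "v \<le> 1"
    show "joint_pgf p u v = joint_pgf (map_pmf prod.swap (joint_of PX (compound_pmf W \<eta>))) u v"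
      unfolding p_def joint_pgf_swap joint_pgf_joint_of[OF uv] joint_pgf_joint_of[OF uv(3,4,1,2)]
      by (rule eq[OF uv])
  qed
  have snd: "map_pmf snd p = PY" by (simp add: p_def map_snd_joint_of)
  have fst: "map_pmf fst p = PX"
    using map_snd_joint_of[of PX "compound_pmf W \<eta>"] by (simp add: p_eq pmf.map_comp comp_def)
  have 1: "pmf p (x, y) = pmf PY y * pmf (compound_pmf Z \<epsilon> y) x" for x y
    by (simp add: p_def pmf_joint_of)
  have 2: "pmf p (x, y) = pmf PX x * pmf (compound_pmf W \<eta> x) y" for x y
    using pmf_map_inj'[of prod.swap "joint_of PX (compound_pmf W \<eta>)" "(y, x)"]
    by (simp add: p_eq pmf_joint_of)
  have car: "bivariate_car p Z \<epsilon> W \<eta>"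
    unfolding bivariate_car_iff snd fst pmf_fps_compound[symmetric] pmf_fps_nth using 1 2 by blast
  have "0 < pmf p (x, y)" for x y
    unfolding 1 using pos pmf_compound_pos[of Z \<epsilon>] by simp
  then have "set_pmf p = UNIV" by (auto simp: set_pmf_iff) (metis less_irrefl)
  then have "regular_bivariate_car p Z \<epsilon> W \<eta>"
    unfolding regular_bivariate_car_def fst snd using car mom by blast
  then show ?thesis using that fst snd p_def by blast
qed

section \<open>Explicit joint laws in the two cases\<close>

lemma pgf_bernoulli:
  assumes "0 \<le> \<alpha>" "\<alpha> \<le> 1"
  shows "pgf (map_pmf of_bool (bernoulli_pmf \<alpha>)) u = 1 - \<alpha> * (1 - u)"
  using assms by (simp add: pgf_def algebra_simps)

lemma pmf_bernoulli_nat: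
  fixes n :: nat
  assumes "0 \<le> \<alpha>" "\<alpha> \<le> 1"
  shows "pmf (map_pmf of_bool (bernoulli_pmf \<alpha>)) n
       = (if n = 0 then 1 - \<alpha> else if n = 1 then \<alpha> else (0::real))"
proof -
  have "(of_bool :: bool \<Rightarrow> nat) -` {n} = (if n = 0 then {False} else if n = 1 then {True} else {})"
  proof (rule set_eqI)
    show "b \<in> of_bool -` {n} \<longleftrightarrow> b \<in> (if n = 0 then {False} else if n = 1 then {True} else {})" for b
      by (cases b) auto
  qed
  then show ?thesis unfolding pmf_map using assms by (simp add: measure_pmf_single)
qed

lemma finite_moments_bernoulli: "finite_moments (map_pmf of_bool (bernoulli_pmf \<alpha>))"
  unfolding finite_moments_def by (auto intro!: integrable_measure_pmf_finite)

text \<open>Both factorizations are the exponential of a bilinear form in 1 - u and 1 - v. The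
  linear terms agree because \<open>lx\<close> and \<open>ly\<close> solve the mean equations
  \<open>e1\<close> and \<open>e2\<close>; the mixed terms agree exactly when
  \<open>ly * \<alpha> = lx * \<beta>\<close>, which is the constraint on the parameters.\<close>

lemma poisson_case_regular:
  assumes "poisson_case Z \<epsilon> W \<eta> \<alpha> \<beta> l\<^sub>\<epsilon> l\<^sub>\<eta>"
  obtains p where "regular_bivariate_car p Z \<epsilon> W \<eta>"
    "map_pmf fst p = poisson_pmf ((\<alpha> * l\<^sub>\<eta> + l\<^sub>\<epsilon>) / (1 - \<alpha> * \<beta>))"
    "map_pmf snd p = poisson_pmf ((\<beta> * l\<^sub>\<epsilon> + l\<^sub>\<eta>) / (1 - \<alpha> * \<beta>))"
proof -
  note c = assms[unfolded poisson_case_def]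
  have ab: "0 \<le> \<alpha>" "\<alpha> < 1" "0 \<le> \<beta>" "\<beta> < 1" "0 < l\<^sub>\<epsilon>" "0 < l\<^sub>\<eta>" using c by auto
  have Zdef: "Z = map_pmf of_bool (bernoulli_pmf \<alpha>)" "W = map_pmf of_bool (bernoulli_pmf \<beta>)"
    "\<epsilon> = poisson_pmf l\<^sub>\<epsilon>" "\<eta> = poisson_pmf l\<^sub>\<eta>" using c by auto
  have "\<alpha> * \<beta> < 1 * 1" using ab by (intro mult_strict_mono') auto
  then have D: "0 < 1 - \<alpha> * \<beta>" by simp
  define lx where "lx = (\<alpha> * l\<^sub>\<eta> + l\<^sub>\<epsilon>) / (1 - \<alpha> * \<beta>)"
  define ly where "ly = (\<beta> * l\<^sub>\<epsilon> + l\<^sub>\<eta>) / (1 - \<alpha> * \<beta>)"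
  have lx: "0 < lx" and ly: "0 < ly"
    using ab D by (auto simp: lx_def ly_def intro!: divide_pos_pos add_nonneg_pos)
  have eqc: "\<alpha> * (l\<^sub>\<eta> * (1 - \<beta>)) = \<beta> * (l\<^sub>\<epsilon> * (1 - \<alpha>))"
    by (rule frac_eq_eq[THEN iffD1, rotated 2]) (use c in auto)
  have e1: "ly * \<alpha> + l\<^sub>\<epsilon> = lx"
    using D by (simp add: lx_def ly_def field_simps)
  have e2: "lx * \<beta> + l\<^sub>\<eta> = ly"
    using D by (simp add: lx_def ly_def field_simps)
  have "\<alpha> * (\<beta> * l\<^sub>\<epsilon> + l\<^sub>\<eta>) = \<beta> * (\<alpha> * l\<^sub>\<eta> + l\<^sub>\<epsilon>)"
    using eqc by (simp add: algebra_simps)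
  then have e3: "ly * \<alpha> = lx * \<beta>"
    unfolding lx_def ly_def times_divide_eq_left by (simp add: mult.commute)
  obtain p where "regular_bivariate_car p Z \<epsilon> W \<eta>" "map_pmf fst p = poisson_pmf lx" "map_pmf snd p = poisson_pmf ly"
  proof (rule regular_bivariate_carI[of "poisson_pmf ly" Z \<epsilon> "poisson_pmf lx" W \<eta>])
    fix u v :: real assume uv: "0 \<le> u" "u \<le> 1" "0 \<le> v" "v \<le> 1"
    have b: "0 \<le> v * (1 - \<alpha> * (1 - u))" "v * (1 - \<alpha> * (1 - u)) \<le> 1"
       "0 \<le> u * (1 - \<beta> * (1 - v))" "u * (1 - \<beta> * (1 - v)) \<le> 1"
      using uv ab mult_le_one[of \<alpha> "1 - u"] mult_le_one[of \<beta> "1 - v"] by (auto intro!: mult_le_one)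
    have "ly * (1 - v * (1 - \<alpha> * (1 - u))) + l\<^sub>\<epsilon> * (1 - u)
        = (ly * \<alpha> + l\<^sub>\<epsilon>) * (1 - u) + ly * (1 - v) - ly * \<alpha> * ((1 - u) * (1 - v))"
      by (simp add: algebra_simps)
    also have "\<dots> = lx * (1 - u) + (lx * \<beta> + l\<^sub>\<eta>) * (1 - v) - lx * \<beta> * ((1 - u) * (1 - v))"
      by (subst e1, subst e2, subst e3) (rule refl)
    also have "\<dots> = lx * (1 - u * (1 - \<beta> * (1 - v))) + l\<^sub>\<eta> * (1 - v)"
      by (simp add: algebra_simps)
    finally have "- (ly * (1 - v * (1 - \<alpha> * (1 - u)))) + - (l\<^sub>\<epsilon> * (1 - u)) =
       - (lx * (1 - u * (1 - \<beta> * (1 - v)))) + - (l\<^sub>\<eta> * (1 - v))" by linarith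
    then show "pgf (poisson_pmf ly) (v * pgf Z u) * pgf \<epsilon> u = pgf (poisson_pmf lx) (u * pgf W v) * pgf \<eta> v"
      using uv ab b lx ly by (simp add: Zdef pgf_bernoulli pgf_poisson flip: exp_add)
  qed (use ab lx ly in \<open>auto simp: Zdef pmf_bernoulli_nat finite_moments_poisson finite_moments_bernoulli\<close>)
  then show ?thesis using that unfolding lx_def ly_def by blast
qed

text \<open>Both factorizations are the power -\<delta> of a bilinear form in 1 - u and 1 - v.
  \<open>e1\<close> and \<open>e2\<close> match the linear terms, and the first extra constraint,
  rewritten as \<open>e3\<close>, matches the mixed ones. The second makes \<Delta>, hence both
  scale parameters, positive.\<close>

lemma neg_binomial_case_regular:
  assumes "neg_binomial_case Z \<epsilon> W \<eta> \<delta> \<theta>\<^sub>1 \<theta>\<^sub>2 \<theta>\<^sub>3 \<theta>\<^sub>4"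
    and D_def: "\<Delta> = 1 - (\<theta>\<^sub>1 - \<theta>\<^sub>2) * (\<theta>\<^sub>3 - \<theta>\<^sub>4)"
    and X_def: "\<theta>\<^sub>X = (\<theta>\<^sub>1 + \<theta>\<^sub>3 * (\<theta>\<^sub>1 - \<theta>\<^sub>2)) / \<Delta>"
    and Y_def: "\<theta>\<^sub>Y = (\<theta>\<^sub>3 + \<theta>\<^sub>1 * (\<theta>\<^sub>3 - \<theta>\<^sub>4)) / \<Delta>"
  obtains p where "regular_bivariate_car p Z \<epsilon> W \<eta>"
    "map_pmf fst p = neg_binomial_real_pmf \<delta> \<theta>\<^sub>X"
    "map_pmf snd p = neg_binomial_real_pmf \<delta> \<theta>\<^sub>Y"
    "0 < \<theta>\<^sub>X" "0 < \<theta>\<^sub>Y" "\<theta>\<^sub>4 * \<theta>\<^sub>X = \<theta>\<^sub>2 * \<theta>\<^sub>Y"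
    "\<forall>u\<in>{0..1}. \<forall>v\<in>{0..1}. joint_pgf p u v =
       1 / (1 + \<theta>\<^sub>X * (1 - u) + \<theta>\<^sub>Y * (1 - v) + \<theta>\<^sub>4 * \<theta>\<^sub>X * (1 - u) * (1 - v)) powr \<delta>"
    "\<epsilon> = neg_binomial_real_pmf \<delta> \<theta>\<^sub>1" "\<eta> = neg_binomial_real_pmf \<delta> \<theta>\<^sub>3"
    "p = joint_of (neg_binomial_real_pmf \<delta> \<theta>\<^sub>Y) (compound_pmf Z \<epsilon>)"
proof -
  note c = assms(1)[unfolded neg_binomial_case_def]
  have t: "\<delta> > 0" "\<theta>\<^sub>1 > 0" "\<theta>\<^sub>2 > -1" "\<theta>\<^sub>3 > 0" "\<theta>\<^sub>4 > -1" "\<theta>\<^sub>1 > \<theta>\<^sub>2" "\<theta>\<^sub>3 > \<theta>\<^sub>4"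
    using c by auto
  have Z: "pgf Z u = (1 + \<theta>\<^sub>2 * (1 - u)) / (1 + \<theta>\<^sub>1 * (1 - u))"
    and W: "pgf W u = (1 + \<theta>\<^sub>4 * (1 - u)) / (1 + \<theta>\<^sub>3 * (1 - u))" if "0 \<le> u" "u \<le> 1" for u
    using c that by auto
  have \<epsilon>: "\<epsilon> = neg_binomial_real_pmf \<delta> \<theta>\<^sub>1" and \<eta>: "\<eta> = neg_binomial_real_pmf \<delta> \<theta>\<^sub>3"
    using c by (auto intro!: neg_binomial_real_eqI)
  have D: "\<Delta> > 0" using c by (simp add: D_def)
  have X: "0 < \<theta>\<^sub>X" and Y: "0 < \<theta>\<^sub>Y"
    using t D by (auto simp: X_def Y_def intro!: divide_pos_pos add_pos_pos mult_pos_pos)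
  have e3: "\<theta>\<^sub>4 * \<theta>\<^sub>X = \<theta>\<^sub>2 * \<theta>\<^sub>Y"
    using c by (simp add: X_def Y_def)
  have e1: "\<theta>\<^sub>X = \<theta>\<^sub>1 + \<theta>\<^sub>Y * (\<theta>\<^sub>1 - \<theta>\<^sub>2)"
    using D unfolding X_def Y_def by (simp add: field_simps) (simp add: D_def algebra_simps)
  have e2: "\<theta>\<^sub>Y = \<theta>\<^sub>3 + \<theta>\<^sub>X * (\<theta>\<^sub>3 - \<theta>\<^sub>4)"
    using D unfolding X_def Y_def by (simp add: field_simps) (simp add: D_def algebra_simps)
  \<comment> \<open>The denominator of the linear fractional function cancels against the base of
    the innovation's generating function. Generic parameters make this usable for both
    factorizations, the second with u and v exchanged.\<close>
  have half: "pgf (neg_binomial_real_pmf \<delta> y) (v * pgf Q u) * pgf (neg_binomial_real_pmf \<delta> a) u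
      = 1 / (1 + x * (1 - u) + y * (1 - v) + b * y * (1 - u) * (1 - v)) powr \<delta>"
    if uv: "0 \<le> u" "u \<le> 1" "0 \<le> v" "v \<le> 1" and Q: "pgf Q u = (1 + b * (1 - u)) / (1 + a * (1 - u))"
      and pos: "0 < y" "0 < a" and x: "x = a + y * (a - b)" for Q x y a b u v
  proof -
    have r: "0 \<le> v * pgf Q u" "v * pgf Q u \<le> 1"
      using uv pgf_nonneg[of u Q] pgf_le_1[of u Q] by (auto intro: mult_le_one)
    have a: "0 < 1 + a * (1 - u)" using uv pos by (intro add_pos_nonneg) auto
    have n: "0 < 1 + y * (1 - v * pgf Q u)" using r pos by (intro add_pos_nonneg) auto
    have "(1 + y * (1 - v * pgf Q u)) * (1 + a * (1 - u))
        = (1 + y) * (1 + a * (1 - u)) - y * v * (pgf Q u * (1 + a * (1 - u)))"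
      by (simp add: algebra_simps)
    also have "pgf Q u * (1 + a * (1 - u)) = 1 + b * (1 - u)" unfolding Q using a by simp
    also have "(1 + y) * (1 + a * (1 - u)) - y * v * (1 + b * (1 - u))
        = 1 + x * (1 - u) + y * (1 - v) + b * y * (1 - u) * (1 - v)"
      unfolding x by (simp add: algebra_simps)
    finally have e: "(1 + y * (1 - v * pgf Q u)) * (1 + a * (1 - u)) = \<dots>" .
    show ?thesis
      unfolding pgf_neg_binomial_real[OF pos(1) t(1) r] pgf_neg_binomial_real[OF pos(2) t(1) uv(1,2)] e[symmetric]
      using a n by (simp add: powr_mult)
  qed
  obtain p where p: "regular_bivariate_car p Z \<epsilon> W \<eta>"
    "map_pmf fst p = neg_binomial_real_pmf \<delta> \<theta>\<^sub>X" "map_pmf snd p = neg_binomial_real_pmf \<delta> \<theta>\<^sub>Y"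
    "p = joint_of (neg_binomial_real_pmf \<delta> \<theta>\<^sub>Y) (compound_pmf Z \<epsilon>)"
  proof (rule regular_bivariate_carI[of "neg_binomial_real_pmf \<delta> \<theta>\<^sub>Y" Z \<epsilon> "neg_binomial_real_pmf \<delta> \<theta>\<^sub>X" W \<eta>])
    fix u v :: real assume uv: "0 \<le> u" "u \<le> 1" "0 \<le> v" "v \<le> 1"
    have s: "1 + \<theta>\<^sub>X * (1 - u) + \<theta>\<^sub>Y * (1 - v) + \<theta>\<^sub>2 * \<theta>\<^sub>Y * (1 - u) * (1 - v)
       = 1 + \<theta>\<^sub>Y * (1 - v) + \<theta>\<^sub>X * (1 - u) + \<theta>\<^sub>4 * \<theta>\<^sub>X * (1 - v) * (1 - u)"
      unfolding e3 by (simp add: algebra_simps)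
    show "pgf (neg_binomial_real_pmf \<delta> \<theta>\<^sub>Y) (v * pgf Z u) * pgf \<epsilon> u
        = pgf (neg_binomial_real_pmf \<delta> \<theta>\<^sub>X) (u * pgf W v) * pgf \<eta> v"
      unfolding \<epsilon> \<eta> half[OF uv Z[OF uv(1,2)] Y t(2) e1] half[OF uv(3,4,1,2) W[OF uv(3,4)] X t(4) e2] s ..
  next
    \<comment> \<open>The bound \<open>\<theta>\<^sub>2 > -1\<close> enters here: it is equivalent
      to \<open>Z\<close> charging 0, given \<open>\<theta>\<^sub>1 > 0\<close>.\<close>
    have "pgf Z 0 = pmf Z 0"
      by (rule pgf_eqI[OF refl]) (use powser_sums_zero[of "pmf Z"] in auto)
    moreover have "0 < (1 + \<theta>\<^sub>2) / (1 + \<theta>\<^sub>1)" using t by (intro divide_pos_pos) auto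
    ultimately show "0 < pmf Z 0" using Z[of 0] by simp
  qed (use t X Y finite_moments_linear_fractional[OF t(2) Z] finite_moments_linear_fractional[OF t(4) W]
      in \<open>auto simp: \<epsilon> \<eta> pmf_neg_binomial_real_pos finite_moments_neg_binomial_real\<close>)
  have joint: "joint_pgf p u v =
       1 / (1 + \<theta>\<^sub>X * (1 - u) + \<theta>\<^sub>Y * (1 - v) + \<theta>\<^sub>4 * \<theta>\<^sub>X * (1 - u) * (1 - v)) powr \<delta>"
    if uv: "0 \<le> u" "u \<le> 1" "0 \<le> v" "v \<le> 1" for u v
    unfolding p(4) joint_pgf_joint_of[OF uv] \<epsilon> e3 half[OF uv Z[OF uv(1,2)] Y t(2) e1] ..
  show ?thesis by (rule that[OF p(1-3) X Y e3 _ \<epsilon> \<eta> p(4)]) (use joint in auto)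
qed

lemma conditional_expectations:
  assumes "regular_bivariate_car p Z \<epsilon> W \<eta>"
  shows "measure_pmf.expectation (X_given_Y p y) real
      = real y * measure_pmf.expectation Z real + measure_pmf.expectation \<epsilon> real"
    and "measure_pmf.expectation (Y_given_X p x) real
      = real x * measure_pmf.expectation W real + measure_pmf.expectation \<eta> real"
proof -
  have full: "set_pmf p = UNIV" using assms by (simp add: regular_bivariate_car_def)
  have "range (snd :: nat \<times> nat \<Rightarrow> nat) = UNIV" "range (fst :: nat \<times> nat \<Rightarrow> nat) = UNIV" by auto
  then have "y \<in> set_pmf (map_pmf snd p)" "x \<in> set_pmf (map_pmf fst p)" by (simp_all add: full)
  then have "X_given_Y p y = compound_pmf Z \<epsilon> y" "Y_given_X p x = compound_pmf W \<eta> x"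
    using assms unfolding regular_bivariate_car_def bivariate_car_def by blast+
  then show "measure_pmf.expectation (X_given_Y p y) real
      = real y * measure_pmf.expectation Z real + measure_pmf.expectation \<epsilon> real"
    and "measure_pmf.expectation (Y_given_X p x) real
      = real x * measure_pmf.expectation W real + measure_pmf.expectation \<eta> real"
    using assms by (simp_all add: regular_bivariate_car_def finite_moments_integrable expectation_compound)
qed

section \<open>The differential equation\<close>

text \<open>Factoring out the constant coefficient isolates the exponential dependence on x, which
  the marginal weights will absorb; what remains is polynomial in x.\<close>

lemma fps_power_nth_0_1_2:
  fixes h :: "real fps"
  assumes "fps_nth h 0 \<noteq> 0"
  shows "fps_nth (h ^ x) 0 = fps_nth h 0 ^ x"
    and "fps_nth (h ^ x) 1 = fps_nth h 0 ^ x * (real x * (fps_nth h 1 / fps_nth h 0))"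
    and "fps_nth (h ^ x) 2 = fps_nth h 0 ^ x * (real x * (fps_nth h 2 / fps_nth h 0)
           + real x * (real x - 1) / 2 * (fps_nth h 1 / fps_nth h 0)\<^sup>2)"
proof (induction x)
  case (Suc x)
  define h0 h1 h2 where hs: "h0 = fps_nth h 0" "h1 = fps_nth h 1" "h2 = fps_nth h 2"
  have nz: "h0 \<noteq> 0" using assms by (simp add: hs)
  have 1: "fps_nth (h ^ Suc x) 1 = h0 * fps_nth (h ^ x) 1 + h1 * fps_nth (h ^ x) 0"
    by (simp add: fps_mult_nth hs)
  have 2: "fps_nth (h ^ Suc x) 2 = h0 * fps_nth (h ^ x) 2 + h1 * fps_nth (h ^ x) 1 + h2 * fps_nth (h ^ x) 0"
    by (simp add: fps_mult_nth hs numeral_2_eq_2)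
  {
    case 1
    show ?case using Suc(1) by simp
  next
    case 2
    show ?case using nz unfolding 1 Suc hs[symmetric] by (simp add: field_simps)
  next
    case 3
    show ?case using nz unfolding 2 Suc hs[symmetric] by (simp add: field_simps power2_eq_square)
  }
qed (simp_all add: fps_one_nth)

text \<open>Each coefficient of \<open>E\<close> is a combination of earlier ones, so uniqueness for
  the linear equation is an induction on the degree.\<close>

lemma fps_linear_ode_zero:
  fixes E M :: "real fps"
  assumes "fps_nth E 0 = 0" "fps_deriv E = M * E"
  shows "E = 0"
proof -
  have "fps_nth E n = 0" for n
  proof (induction n rule: less_induct)
    case (less n)
    show ?case
    proof (cases n)
      case (Suc m)
      have "real (Suc m) * fps_nth E (Suc m) = fps_nth (fps_deriv E) m" by simp
      also have "\<dots> = (\<Sum>i=0..m. fps_nth M i * fps_nth E (m - i))"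
        unfolding assms(2) fps_mult_nth ..
      also have "\<dots> = 0" by (rule sum.neutral) (use less Suc in auto)
      finally show ?thesis using Suc by simp
    qed (use assms in simp)
  qed
  then show ?thesis by (simp add: fps_eq_iff)
qed

text \<open>The dictionary from polynomial factors in x, written in the basis 1, x, x(x - 1), to
  differential operators on the series.\<close>

lemma fps_X_deriv_nth:
  "fps_nth (fps_X * fps_deriv g) x = real x * fps_nth g x"
  "fps_nth (fps_X * (fps_X * fps_deriv (fps_deriv g))) x = real x * (real x - 1) * fps_nth g x"
  for g :: "real fps"
proof -
  show "fps_nth (fps_X * fps_deriv g) x = real x * fps_nth g x"
    by (cases x) auto
  show "fps_nth (fps_X * (fps_X * fps_deriv (fps_deriv g))) x = real x * (real x - 1) * fps_nth g x"
    by (cases x; cases "x - 1") (auto simp: algebra_simps)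
qed

text \<open>Both expressions for \<open>P(X = x, Y = y)\<close>, with \<open>a\<close> and \<open>b\<close> the marginal weights of \<open>X\<close> and \<open>Y\<close>;
  normalization plays no role here.\<close>

locale compound_matrix =
  fixes f g h k :: "real fps" and a b :: "nat \<Rightarrow> real"
  assumes rows: "b y * fps_nth (f ^ y * g) x = a x * fps_nth (h ^ x * k) y"
    and a_pos: "0 < a x" and b_pos: "0 < b y"
    and f0: "0 < fps_nth f 0" and h0: "0 < fps_nth h 0"
    and g_pos: "0 < fps_nth g x" and k_pos: "0 < fps_nth k y"
begin

lemma row_0: "b 0 * fps_nth g x = a x * fps_nth h 0 ^ x * fps_nth k 0"
  using rows[of 0 x] h0 by (simp add: fps_power_nth_0_1_2)

text \<open>Row y = 0 determines the weights of X: they are proportional to g_x / h(0)^x. This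
  eliminates \<open>a\<close> from the rows y = 1 and y = 2, and later yields the normalizability
  condition.\<close>

lemma weight: "a x * fps_nth h 0 ^ x = a 0 / fps_nth g 0 * fps_nth g x"
proof -
  have "b 0 = a 0 * fps_nth k 0 / fps_nth g 0" using row_0[of 0] g_pos[of 0] by (simp add: field_simps)
  then have "(a 0 / fps_nth g 0 * fps_nth g x) * fps_nth k 0 = (a x * fps_nth h 0 ^ x) * fps_nth k 0"
    using row_0[of x] by (simp add: mult_ac)
  then show ?thesis using k_pos[of 0] by (metis mult_right_cancel less_irrefl)
qed

text \<open>In row y = 1 the instance x = 0 determines \<open>b 1\<close>; after substituting it
  only ratios of coefficients of \<open>h\<close> and \<open>k\<close> remain.\<close>

lemma row_1:
  "fps_nth (f * g) x
     = fps_nth f 0 * (1 + fps_nth h 1 / fps_nth h 0 * (fps_nth k 0 / fps_nth k 1) * real x) * fps_nth g x"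
proof -
  define e where "e = fps_nth h 1 / fps_nth h 0"
  have nz: "fps_nth g 0 \<noteq> 0" "fps_nth f 0 \<noteq> 0" "fps_nth k 1 \<noteq> 0" "a 0 \<noteq> 0"
    using g_pos[of 0] f0 k_pos[of 1] a_pos[of 0] by auto
  have "fps_nth (h ^ x * k) 1 = fps_nth h 0 ^ x * (fps_nth k 1 + fps_nth k 0 * (real x * e))" for x
    using h0 by (simp add: fps_mult_nth fps_power_nth_0_1_2[simplified] algebra_simps e_def)
  then have eq: "b 1 * fps_nth (f * g) x
      = a 0 / fps_nth g 0 * fps_nth g x * (fps_nth k 1 + fps_nth k 0 * (real x * e))" for x
    using rows[of 1 x] unfolding weight[symmetric] by simp
  have "b 1 * (fps_nth f 0 * fps_nth g 0) = a 0 * fps_nth k 1"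
    using eq[of 0] nz by simp
  then have "b 1 = a 0 * fps_nth k 1 / (fps_nth f 0 * fps_nth g 0)" using nz by (simp add: field_simps)
  then have "a 0 * fps_nth k 1 / (fps_nth f 0 * fps_nth g 0) * fps_nth (f * g) x
      = a 0 / fps_nth g 0 * fps_nth g x * (fps_nth k 1 + fps_nth k 0 * (real x * e))"
    using eq[of x] by simp
  moreover have "F = ff * (1 + e * (k0 / k1) * X) * G"
    if "A * k1 / (ff * g0) * F = A / g0 * G * (k1 + k0 * (X * e))"
      "A \<noteq> 0" "k1 \<noteq> 0" "ff \<noteq> 0" "g0 \<noteq> 0" for F ff k1 k0 X G A g0 :: real
  proof -
    have "F = ff * g0 / (A * k1) * (A * k1 / (ff * g0) * F)" using that(2-) by simp
    also have "\<dots> = ff * (1 / k1 * (k1 + k0 * (X * e))) * G"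
      unfolding that(1) using that(2-) by simp
    also have "1 / k1 * (k1 + k0 * (X * e)) = 1 + e * (k0 / k1) * X"
      using that(3) by (simp add: add_divide_distrib)
    finally show ?thesis .
  qed
  ultimately show ?thesis using nz unfolding e_def[symmetric] by blast
qed

text \<open>As for row 1, with \<open>b 2\<close> eliminated through x = 0. The polynomial is split
  along x and x(x - 1) to match \<open>fps_X_deriv_nth\<close>.\<close>

lemma row_2:
  fixes x :: nat
  defines "e \<equiv> fps_nth h 1 / fps_nth h 0" and "e2 \<equiv> fps_nth h 2 / fps_nth h 0"
  shows "fps_nth (f\<^sup>2 * g) x = (fps_nth f 0)\<^sup>2 * (1 + (fps_nth k 1 / fps_nth k 2 * e + fps_nth k 0 / fps_nth k 2 * e2) * real x
     + fps_nth k 0 / fps_nth k 2 * e\<^sup>2 / 2 * (real x * (real x - 1))) * fps_nth g x"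
proof -
  have nz: "fps_nth g 0 \<noteq> 0" "fps_nth f 0 \<noteq> 0" "fps_nth k 2 \<noteq> 0" "a 0 \<noteq> 0"
    using g_pos[of 0] f0 k_pos[of 2] a_pos[of 0] by auto
  have "fps_nth (h ^ x * k) 2 = fps_nth h 0 ^ x * (fps_nth k 2 + fps_nth k 1 * (real x * e)
      + fps_nth k 0 * (real x * e2 + real x * (real x - 1) / 2 * e\<^sup>2))" for x
  proof -
    have "fps_nth (h ^ x * k) 2
        = fps_nth (h ^ x) 0 * fps_nth k 2 + fps_nth (h ^ x) 1 * fps_nth k 1 + fps_nth (h ^ x) 2 * fps_nth k 0"
      by (simp add: fps_mult_nth numeral_2_eq_2)
    then show ?thesis
      using h0 by (simp only: fps_power_nth_0_1_2 e_def e2_def) (simp add: algebra_simps)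
  qed
  then have eq: "b 2 * fps_nth (f\<^sup>2 * g) x
      = a 0 / fps_nth g 0 * fps_nth g x * (fps_nth k 2 + fps_nth k 1 * (real x * e)
      + fps_nth k 0 * (real x * e2 + real x * (real x - 1) / 2 * e\<^sup>2))" for x
    using rows[of 2 x] unfolding weight[symmetric] by simp
  have "b 2 * ((fps_nth f 0)\<^sup>2 * fps_nth g 0) = a 0 * fps_nth k 2"
    using eq[of 0] nz by (simp add: power2_eq_square)
  then have "b 2 = a 0 * fps_nth k 2 / ((fps_nth f 0)\<^sup>2 * fps_nth g 0)" using nz by (simp add: field_simps)
  then have "a 0 * fps_nth k 2 / ((fps_nth f 0)\<^sup>2 * fps_nth g 0) * fps_nth (f\<^sup>2 * g) x
      = a 0 / fps_nth g 0 * fps_nth g x * (fps_nth k 2 + fps_nth k 1 * (real x * e)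
      + fps_nth k 0 * (real x * e2 + real x * (real x - 1) / 2 * e\<^sup>2))"
    using eq[of x] by simp
  moreover have "F = ff * (1 + (k1 / k2 * e + k0 / k2 * e2) * X + k0 / k2 * e\<^sup>2 / 2 * (X * (X - 1))) * G"
    if "A * k2 / (ff * g0) * F = A / g0 * G * (k2 + k1 * (X * e) + k0 * (X * e2 + X * (X - 1) / 2 * e\<^sup>2))"
      "A \<noteq> 0" "k2 \<noteq> 0" "ff \<noteq> 0" "g0 \<noteq> 0" for F ff k1 k2 k0 X G A g0 :: real
  proof -
    have "F = ff * g0 / (A * k2) * (A * k2 / (ff * g0) * F)" using that(2-) by simp
    also have "\<dots> = ff * (1 / k2 * (k2 + k1 * (X * e) + k0 * (X * e2 + X * (X - 1) / 2 * e\<^sup>2))) * G"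
      unfolding that(1) using that(2-) by simp
    also have "1 / k2 * (k2 + k1 * (X * e) + k0 * (X * e2 + X * (X - 1) / 2 * e\<^sup>2))
        = 1 + (k1 / k2 * e + k0 / k2 * e2) * X + k0 / k2 * e\<^sup>2 / 2 * (X * (X - 1))"
      using that(3) by (simp add: add_divide_distrib distrib_left distrib_right mult_ac)
    finally show ?thesis .
  qed
  ultimately show ?thesis using nz by simp
qed

text \<open>Without a linear coefficient in \<open>h\<close>, row 1 is proportional to row 0, and
  \<open>g\<close> cancels. For probability laws this says that \<open>Z\<close> vanishes as soon as
  \<open>W\<close> does not charge 1.\<close>

lemma degenerate:
  assumes "fps_nth h 1 = 0"
  shows "f = fps_const (fps_nth f 0)"
proof -
  have "f * g = fps_const (fps_nth f 0) * g"
    using assms by (simp add: fps_eq_iff row_1)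
  moreover have "g \<noteq> 0" using g_pos[of 0] by auto
  ultimately show ?thesis by simp
qed

text \<open>\<open>q\<close> is the logarithmic derivative of \<open>g\<close> at 0 and
  \<open>B\<close> the slope of the polynomial in \<open>row_1\<close>. The first conclusion is the
  Panjer recursion for \<open>g\<close>, the second the linear fractional form of \<open>f\<close>
  with its denominator cleared.\<close>

lemma solution:
  assumes h1: "fps_nth h 1 \<noteq> 0"
  defines "q \<equiv> fps_nth g 1 / fps_nth g 0"
    and "C \<equiv> 2 * fps_nth k 0 * fps_nth k 2 / (fps_nth k 1)\<^sup>2 - 1"
    and "B \<equiv> fps_nth h 1 / fps_nth h 0 * (fps_nth k 0 / fps_nth k 1)"
  shows "real (Suc n) * fps_nth g (Suc n) = (q + C * q * real n) * fps_nth g n"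
    and "f * (1 - fps_const (C * q) * fps_X) = fps_const (fps_nth f 0) * (1 + fps_const (B * q - C * q) * fps_X)"
proof -
  define e where "e = fps_nth h 1 / fps_nth h 0"
  define s where "s = fps_nth k 1 / fps_nth k 2 * e + fps_nth k 0 / fps_nth k 2 * (fps_nth h 2 / fps_nth h 0)"
  define r where "r = fps_nth k 0 / fps_nth k 2 * e\<^sup>2 / 2"
  define g' where "g' = fps_deriv g"
  define g'' where "g'' = fps_deriv g'"
  define c0 where "c0 = fps_const (fps_nth f 0)"
  have g0: "fps_nth g 0 \<noteq> 0" "g \<noteq> 0" using g_pos[of 0] by auto
  have c0: "c0 \<noteq> 0" using f0 by (simp add: c0_def)
  have kp: "0 < fps_nth k 0" "0 < fps_nth k 1" "0 < fps_nth k 2" using k_pos by auto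
  have e: "e \<noteq> 0" using h1 h0 by (simp add: e_def)
  have r: "r \<noteq> 0" using e kp by (simp add: r_def)
  have "fps_nth (f * g) x = fps_nth (c0 * (g + fps_const B * (fps_X * g'))) x" for x
    unfolding row_1 c0_def g'_def fps_mult_left_const_nth fps_add_nth fps_X_deriv_nth B_def
    by (simp add: algebra_simps)
  then have 1: "f * g = c0 * (g + fps_const B * (fps_X * g'))" by (simp add: fps_eq_iff)
  have "fps_nth (f\<^sup>2 * g) x = fps_nth (fps_const ((fps_nth f 0)\<^sup>2) * (g + fps_const s * (fps_X * g') + fps_const r * (fps_X * (fps_X * g'')))) x" for x
    unfolding row_2 g'_def g''_def fps_mult_left_const_nth fps_add_nth fps_X_deriv_nth s_def r_def e_def
    by (simp add: algebra_simps)
  then have 2: "f\<^sup>2 * g = c0\<^sup>2 * (g + fps_const s * (fps_X * g') + fps_const r * (fps_X * (fps_X * g'')))"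
    by (simp add: fps_eq_iff c0_def fps_const_power)
  have "c0\<^sup>2 * (g + fps_const B * (fps_X * g'))\<^sup>2 = (f * g)\<^sup>2" unfolding 1 by (simp add: power_mult_distrib)
  also have "\<dots> = (f\<^sup>2 * g) * g" by (simp add: power2_eq_square mult_ac)
  also have "\<dots> = c0\<^sup>2 * ((g + fps_const s * (fps_X * g') + fps_const r * (fps_X * (fps_X * g''))) * g)"
    unfolding 2 by (simp add: mult.assoc)
  finally have "(g + fps_const B * (fps_X * g'))\<^sup>2 = (g + fps_const s * (fps_X * g') + fps_const r * (fps_X * (fps_X * g''))) * g"
    using c0 by simp
  moreover have "X * ((p + p - s) * y * y' + X * (p\<^sup>2 * y'\<^sup>2 - r * y * y'')) = 0"
    if "(y + p * (X * y'))\<^sup>2 = (y + s * (X * y') + r * (X * (X * y''))) * y" for p s r X y y' y'' :: "real fps"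
    using that by (simp add: power2_eq_square algebra_simps)
  ultimately have "fps_X * ((fps_const B + fps_const B - fps_const s) * g * g' + fps_X * ((fps_const B)\<^sup>2 * g'\<^sup>2 - fps_const r * g * g'')) = 0"
    by blast
  then have 3: "(fps_const B + fps_const B - fps_const s) * g * g' + fps_X * ((fps_const B)\<^sup>2 * g'\<^sup>2 - fps_const r * g * g'') = 0"
    by simp
  \<comment> \<open>The other summand carries a factor \<open>fps_X\<close>, so the constant
    coefficient isolates the g g' term; g(0) and g'(0) are positive.\<close>
  have "(B + B - s) * fps_nth g 0 * fps_nth g 1 = 0"
    using arg_cong[OF 3, of "\<lambda>t. fps_nth t 0"] by (simp add: g'_def)
  then have "B + B - s = 0" using g_pos[of 0] g_pos[of 1] by simp
  then have "fps_const B + fps_const B - fps_const s = 0" by simp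
  with 3 have 4: "(fps_const B)\<^sup>2 * g'\<^sup>2 = fps_const r * (g * g'')" by (simp add: mult.assoc)
  \<comment> \<open>This equation is the origin of \<open>C\<close>: the ratio
    \<open>B\<^sup>2 / r\<close> no longer involves \<open>h\<close>.\<close>
  have "B\<^sup>2 = r * (1 + C)"
    using kp unfolding B_def r_def C_def e_def[symmetric] by (simp add: field_simps power2_eq_square)
  then have "fps_const r * (g * g'') = fps_const r * (fps_const (1 + C) * g'\<^sup>2)"
    using 4 by (simp add: fps_const_power mult.assoc[symmetric])
  then have ode: "g * g'' = fps_const (1 + C) * g'\<^sup>2" using r by simp
  define c where "c = fps_const (C * q)"
  define Q where "Q = fps_const q"
  define K where "K = fps_const C"
  have c_eq: "c = K * Q" by (simp add: c_def K_def Q_def)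
  have ode': "g * g'' = (1 + K) * g'\<^sup>2" unfolding ode K_def by (simp add: distrib_right flip: fps_const_add)
  \<comment> \<open>\<open>E\<close> is the defect in the first-order equation. The second-order
    equation makes it solve a homogeneous linear equation, and the choice of \<open>q\<close> makes
    its constant coefficient 0.\<close>
  define E where "E = g' - c * (fps_X * g') - Q * g"
  have dE: "fps_deriv E = g'' - c * (g' + fps_X * g'') - Q * g'"
    by (simp add: E_def g''_def c_def Q_def g'_def)
  have "g * fps_deriv E = g * g'' - c * (g * g' + fps_X * (g * g'')) - Q * (g * g')"
    unfolding dE by (simp add: algebra_simps)
  also have "\<dots> = (1 + K) * g' * E"
    unfolding ode' E_def c_eq by (simp add: algebra_simps power2_eq_square)
  finally have "g * fps_deriv E = (1 + K) * g' * E" .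
  then have "inverse g * (g * fps_deriv E) = (inverse g * ((1 + K) * g')) * E"
    by (simp add: mult.assoc)
  then have "fps_deriv E = (inverse g * ((1 + K) * g')) * E"
    using inverse_mult_eq_1[OF g0(1)] by (simp add: mult.assoc[symmetric])
  moreover have "fps_nth E 0 = 0" using g0 by (simp add: E_def g'_def Q_def q_def)
  ultimately have "E = 0" by (rule fps_linear_ode_zero[rotated])
  then have 5: "g' - c * (fps_X * g') = Q * g" by (simp add: E_def)
  show "real (Suc n) * fps_nth g (Suc n) = (q + C * q * real n) * fps_nth g n"
    using arg_cong[OF 5, of "\<lambda>t. fps_nth t n"]
    unfolding g'_def c_def Q_def fps_sub_nth fps_mult_left_const_nth fps_X_deriv_nth
    by (simp add: algebra_simps)
  \<comment> \<open>Multiplying row 1 by 1 - c X turns its derivative term into a multiple of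
    \<open>g\<close>, which can then be cancelled.\<close>
  have "f * (1 - c * fps_X) * g = (f * g) * (1 - c * fps_X)" by (simp add: mult_ac)
  also have "\<dots> = c0 * (g * (1 - c * fps_X) + fps_const B * fps_X * (g' - c * (fps_X * g')))"
    unfolding 1 by (simp add: algebra_simps)
  also have "\<dots> = c0 * (1 + (fps_const B * Q - c) * fps_X) * g"
    unfolding 5 by (simp add: algebra_simps)
  finally show "f * (1 - fps_const (C * q) * fps_X)
      = fps_const (fps_nth f 0) * (1 + fps_const (B * q - C * q) * fps_X)"
    using g0(2) by (simp add: c0_def c_def Q_def)
qed

lemma compound_matrix_transpose: "compound_matrix h k f g b a"
  by unfold_locales (use rows a_pos b_pos f0 h0 g_pos k_pos in auto)

end

section \<open>Necessity\<close>

text \<open>A negative \<open>c\<close> would make the factor a + c n negative for large n. If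
  \<open>c\<close> were at least 1, then n * \<open>pmf q n\<close> would be nondecreasing for n >=
  1, and the total mass would dominate a multiple of the harmonic series.\<close>

lemma panjer_pos_bounds:
  assumes P: "panjer a c q" and pos: "\<And>n. 0 < pmf q n"
  shows "0 < a" "0 \<le> c" "c < 1"
proof -
  have fac: "0 < a + c * real n" for n
    using P pos[of n] pos[of "Suc n"] unfolding panjer_def
    by (metis mult_pos_pos of_nat_0_less_iff zero_less_Suc zero_less_mult_pos2)
  show a: "0 < a" using fac[of 0] by simp
  show c: "0 \<le> c"
  proof (rule ccontr)
    assume "\<not> 0 \<le> c"
    then obtain n where "a < real n * (- c)" using reals_Archimedean3[of "- c"] by auto
    then show False using fac[of n] by (simp add: algebra_simps)
  qed
  show "c < 1"
  proof (rule ccontr)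
    assume "\<not> c < 1"
    then have c1: "1 \<le> c" by simp
    have ge: "pmf q 1 \<le> real (Suc n) * pmf q (Suc n)" for n
    proof (induction n)
      case (Suc n)
      have "real (Suc n) \<le> a + c * real (Suc n)" using add_increasing[OF less_imp_le[OF a] mult_right_mono[OF c1 of_nat_0_le_iff, of "Suc n"]] by simp
      then have "real (Suc n) * pmf q (Suc n) \<le> real (Suc (Suc n)) * pmf q (Suc (Suc n))"
        using P pos[of "Suc n"] unfolding panjer_def by (metis less_imp_le mult_right_mono)
      with Suc show ?case by linarith
    qed simp
    have "summable (\<lambda>n. pmf q (Suc n))" using pmf_nat_sums[of q] by (simp add: summable_Suc_iff sums_iff)
    then have "summable (\<lambda>n. pmf q (Suc n) * (1 / pmf q 1))" by (rule summable_mult2)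
    then have "summable (\<lambda>n. inverse (real (Suc n)))"
    proof (rule summable_comparison_test'[where N = 0])
      fix n
      show "norm (inverse (real (Suc n))) \<le> pmf q (Suc n) * (1 / pmf q 1)"
        using ge[of n] pos[of 1] by (simp add: field_simps)
    qed
    then show False using not_summable_harmonic[where 'a = real] summable_Suc_iff[of "\<lambda>n. inverse (real n)"] by blast
  qed
qed

lemma pmf_fps_eq_const_imp_return:
  assumes "pmf_fps q = fps_const r"
  shows "q = return_pmf 0"
proof -
  have "pmf q n = 0" if "n \<noteq> 0" for n
    using arg_cong[OF assms, of "\<lambda>t. fps_nth t n"] that by simp
  then have "set_pmf q \<subseteq> {0}" by (metis insertI1 set_pmf_iff subsetI)
  then show ?thesis by (rule set_pmf_subset_singleton[THEN iffD1])
qed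

text \<open>From 1 on the coefficients are geometric with ratio \<open>c\<close>. Total mass 1 ties
  \<open>d\<close> to \<open>pmf q 0\<close>, so the law depends only on \<open>pmf q 0\<close> and
  \<open>c\<close>.\<close>

lemma pmf_linear_fractional_fps:
  assumes eq: "pmf_fps q * (1 - fps_const c * fps_X) = fps_const (pmf q 0) * (1 + fps_const (d - c) * fps_X)"
    and c: "0 \<le> c" "c < 1"
  shows "pmf q 1 = pmf q 0 * d"
    and "c = 0 \<Longrightarrow> n \<ge> 2 \<Longrightarrow> pmf q n = 0"
    and "pmf q 0 * d = (1 - pmf q 0) * (1 - c)"
    and "0 \<le> u \<Longrightarrow> u \<le> 1 \<Longrightarrow> pgf q u = (pmf q 0 + (1 - c - pmf q 0) * u) / (1 - c * u)"
proof -
  have rec: "pmf q (Suc n) - c * pmf q n = (if n = 0 then pmf q 0 * (d - c) else 0)" for n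
  proof -
    have "fps_nth (pmf_fps q * (1 - fps_const c * fps_X)) (Suc n) = pmf q (Suc n) - c * pmf q n"
      by (simp add: right_diff_distrib mult.assoc[symmetric] mult.commute[of _ "fps_const c"])
    then show ?thesis unfolding eq by (simp add: distrib_left mult.assoc[symmetric])
  qed
  show 1: "pmf q 1 = pmf q 0 * d" using rec[of 0] by (simp add: algebra_simps)
  have z: "pmf q (Suc n) = pmf q 0 * d * c ^ n" for n
  proof (induction n)
    case (Suc n)
    then show ?case using rec[of "Suc n"] by simp
  qed (use 1 in simp)
  show "pmf q n = 0" if c0: "c = 0" and n2: "n \<ge> 2"
  proof -
    obtain m where "n = Suc (Suc m)" using le_Suc_ex[OF n2] by auto
    then show ?thesis using z[of "Suc m"] c0 by simp
  qed
  have cu: "norm (c * u) < 1" if "0 \<le> u" "u \<le> 1" for u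
    using that c mult_left_le[of u c] by (simp add: abs_mult)
  have pgf: "pgf q u = pmf q 0 * d * u / (1 - c * u) + pmf q 0" if u: "0 \<le> u" "u \<le> 1" for u
  proof -
    have "(\<lambda>n. pmf q 0 * d * u * (c * u) ^ n) sums (pmf q 0 * d * u * (1 / (1 - c * u)))"
      by (rule sums_mult[OF geometric_sums[OF cu[OF u]]])
    moreover have "pmf q 0 * d * u * (c * u) ^ n = pmf q (Suc n) * u ^ Suc n" for n
      unfolding z by (simp add: power_mult_distrib)
    ultimately have "(\<lambda>n. pmf q (Suc n) * u ^ Suc n) sums (pmf q 0 * d * u * (1 / (1 - c * u)))"
      by (simp only:)
    then have "(\<lambda>n. pmf q n * u ^ n) sums (pmf q 0 * d * u * (1 / (1 - c * u)) + pmf q 0 * u ^ 0)"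
      by (rule sums_Suc)
    then show ?thesis using sums_unique2[OF pgf_sums[OF u]] by force
  qed
  have "pmf q 0 * d / (1 - c) + pmf q 0 = 1" using pgf[of 1] by (simp add: pgf_def)
  then have "pmf q 0 * d = (1 - c) * (1 - pmf q 0)" using c by (simp add: field_simps)
  then show d: "pmf q 0 * d = (1 - pmf q 0) * (1 - c)" by (simp add: mult.commute)
  show "pgf q u = (pmf q 0 + (1 - c - pmf q 0) * u) / (1 - c * u)" if u: "0 \<le> u" "u \<le> 1"
  proof -
    have "0 < 1 - c * u" using cu[OF u] by simp
    then show ?thesis unfolding pgf[OF u] d by (simp add: field_simps)
  qed
qed

text \<open>After multiplication by \<open>D * E\<close> both sides equal \<open>\<theta>\<^sub>1 *
  \<theta>\<^sub>3 * (1 - m) * (1 + m * (\<theta>\<^sub>1 + \<theta>\<^sub>3 + \<theta>\<^sub>1 *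
  \<theta>\<^sub>3))\<close>, which is symmetric under exchanging the two directions. The common
  \<open>m\<close> is essential.\<close>

lemma neg_binomial_constraint:
  fixes \<theta>\<^sub>1 \<theta>\<^sub>2 \<theta>\<^sub>3 \<theta>\<^sub>4 m :: real
  assumes 2: "\<theta>\<^sub>2 * (1 + m * \<theta>\<^sub>1) = \<theta>\<^sub>1 * (1 - m)" and 4: "\<theta>\<^sub>4 * (1 + m * \<theta>\<^sub>3) = \<theta>\<^sub>3 * (1 - m)"
    and pos: "0 < m" "0 < \<theta>\<^sub>1" "0 < \<theta>\<^sub>3"
  shows "\<theta>\<^sub>4 * (\<theta>\<^sub>1 + \<theta>\<^sub>3 * (\<theta>\<^sub>1 - \<theta>\<^sub>2)) = \<theta>\<^sub>2 * (\<theta>\<^sub>3 + \<theta>\<^sub>1 * (\<theta>\<^sub>3 - \<theta>\<^sub>4))"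
proof -
  define D E where "D = 1 + m * \<theta>\<^sub>1" and "E = 1 + m * \<theta>\<^sub>3"
  have DE: "0 < D" "0 < E" using pos by (auto simp: D_def E_def intro: add_pos_pos)
  have "(\<theta>\<^sub>4 * (\<theta>\<^sub>1 + \<theta>\<^sub>3 * (\<theta>\<^sub>1 - \<theta>\<^sub>2))) * (D * E) = (\<theta>\<^sub>4 * E) * (\<theta>\<^sub>1 * D + \<theta>\<^sub>3 * (\<theta>\<^sub>1 * D - \<theta>\<^sub>2 * D))"
    by (simp add: algebra_simps)
  also have "\<dots> = (\<theta>\<^sub>2 * D) * (\<theta>\<^sub>3 * E + \<theta>\<^sub>1 * (\<theta>\<^sub>3 * E - \<theta>\<^sub>4 * E))"
    using 2 4 unfolding D_def[symmetric] E_def[symmetric]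
    by (simp only:) (simp add: D_def E_def algebra_simps)
  also have "\<dots> = (\<theta>\<^sub>2 * (\<theta>\<^sub>3 + \<theta>\<^sub>1 * (\<theta>\<^sub>3 - \<theta>\<^sub>4))) * (D * E)"
    by (simp add: algebra_simps)
  finally show ?thesis using DE by simp
qed

section \<open>From the model to the parameters\<close>

text \<open>Full support makes every cell positive, hence both factors in each of its two
  expressions. Row y = 0 gives positivity of all coefficients for \<epsilon>; the cell (0, 1) shows
  that \<open>Z\<close> charges 0. The other direction is the same.\<close>

lemma regular_imp_compound_matrix:
  assumes "regular_bivariate_car p Z \<epsilon> W \<eta>"
  shows "compound_matrix (pmf_fps Z) (pmf_fps \<epsilon>) (pmf_fps W) (pmf_fps \<eta>)
           (pmf (map_pmf fst p)) (pmf (map_pmf snd p))"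
proof -
  let ?a = "pmf (map_pmf fst p)" and ?b = "pmf (map_pmf snd p)"
  have 1: "pmf p (x, y) = ?b y * fps_nth (pmf_fps Z ^ y * pmf_fps \<epsilon>) x"
    and 2: "pmf p (x, y) = ?a x * fps_nth (pmf_fps W ^ x * pmf_fps \<eta>) y" for x y
    using assms unfolding regular_bivariate_car_def bivariate_car_iff by blast+
  have p: "0 < pmf p z" for z
    using assms by (simp add: regular_bivariate_car_def pmf_positive_iff)
  have a: "0 < ?a x" and b: "0 < ?b y" for x y
    using p[of "(x, y)"] 1[of x y] 2[of x y] by (metis less_irrefl mult_zero_left pmf_nonneg antisym_conv2)+
  have Z: "0 < fps_nth (pmf_fps Z ^ y * pmf_fps \<epsilon>) x" and W: "0 < fps_nth (pmf_fps W ^ x * pmf_fps \<eta>) y" for x y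
    using p[of "(x, y)"] 1[of x y] 2[of x y] a b by (metis zero_less_mult_pos)+
  have "pmf Z 0 \<noteq> 0" using Z[of 1 0] by auto
  moreover have "pmf W 0 \<noteq> 0" using W[of 1 0] by auto
  moreover have "0 < pmf \<epsilon> x" for x using Z[of 0 x] by simp
  moreover have "0 < pmf \<eta> y" for y using W[of 0 y] by simp
  ultimately show ?thesis
    using a b 1 2 by unfold_locales (auto simp: order_less_le)
qed

text \<open>If one of the two laws does not charge 1, the other is concentrated at 0; it then does
  not charge 1 either, so the first is concentrated at 0 as well.\<close>

lemma regular_nondegenerate:
  assumes R: "regular_bivariate_car p Z \<epsilon> W \<eta>" and nd: "\<not> (Z = return_pmf 0 \<and> W = return_pmf 0)"
  shows "pmf Z 1 \<noteq> 0" "pmf W 1 \<noteq> 0"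
proof -
  interpret M: compound_matrix "pmf_fps Z" "pmf_fps \<epsilon>" "pmf_fps W" "pmf_fps \<eta>" "pmf (map_pmf fst p)" "pmf (map_pmf snd p)"
    by (rule regular_imp_compound_matrix[OF R])
  interpret T: compound_matrix "pmf_fps W" "pmf_fps \<eta>" "pmf_fps Z" "pmf_fps \<epsilon>" "pmf (map_pmf snd p)" "pmf (map_pmf fst p)"
    by (rule M.compound_matrix_transpose)
  have "pmf W 1 = 0 \<Longrightarrow> Z = return_pmf 0" "pmf Z 1 = 0 \<Longrightarrow> W = return_pmf 0"
    using M.degenerate T.degenerate pmf_fps_eq_const_imp_return by (metis pmf_fps_nth)+
  moreover have "pmf (return_pmf 0) (1::nat) = 0" by simp
  ultimately show "pmf Z 1 \<noteq> 0" "pmf W 1 \<noteq> 0" using nd by metis+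
qed

lemma regular_imp_cases:
  assumes R: "regular_bivariate_car p Z \<epsilon> W \<eta>" and nd: "\<not> (Z = return_pmf 0 \<and> W = return_pmf 0)"
  shows "(\<exists>\<alpha> \<beta> l\<^sub>\<epsilon> l\<^sub>\<eta>. poisson_case Z \<epsilon> W \<eta> \<alpha> \<beta> l\<^sub>\<epsilon> l\<^sub>\<eta>) \<or>
         (\<exists>\<delta> \<theta>\<^sub>1 \<theta>\<^sub>2 \<theta>\<^sub>3 \<theta>\<^sub>4. neg_binomial_case Z \<epsilon> W \<eta> \<delta> \<theta>\<^sub>1 \<theta>\<^sub>2 \<theta>\<^sub>3 \<theta>\<^sub>4)"
proof -
  define f0 h0 where "f0 = pmf Z 0" and "h0 = pmf W 0"
  define q r where "q = pmf \<epsilon> 1 / pmf \<epsilon> 0" and "r = pmf \<eta> 1 / pmf \<eta> 0"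
  define C where "C = 2 * pmf \<eta> 0 * pmf \<eta> 2 / (pmf \<eta> 1)\<^sup>2 - 1"
  define C' where "C' = 2 * pmf \<epsilon> 0 * pmf \<epsilon> 2 / (pmf \<epsilon> 1)\<^sup>2 - 1"
  define B where "B = pmf W 1 / h0 * (pmf \<eta> 0 / pmf \<eta> 1)"
  define B' where "B' = pmf Z 1 / f0 * (pmf \<epsilon> 0 / pmf \<epsilon> 1)"
  interpret M: compound_matrix "pmf_fps Z" "pmf_fps \<epsilon>" "pmf_fps W" "pmf_fps \<eta>" "pmf (map_pmf fst p)" "pmf (map_pmf snd p)"
    by (rule regular_imp_compound_matrix[OF R])
  interpret T: compound_matrix "pmf_fps W" "pmf_fps \<eta>" "pmf_fps Z" "pmf_fps \<epsilon>" "pmf (map_pmf snd p)" "pmf (map_pmf fst p)"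
    by (rule M.compound_matrix_transpose)
  note nz = regular_nondegenerate[OF R nd]
  have f0: "0 < f0" and h0: "0 < h0" using M.f0 M.h0 by (simp_all add: f0_def h0_def)
  have \<epsilon>: "0 < pmf \<epsilon> n" and \<eta>: "0 < pmf \<eta> n" for n using M.g_pos M.k_pos by simp_all
  have q: "0 < q" and r: "0 < r" using \<epsilon> \<eta> by (simp_all add: q_def r_def)
  have B: "0 < B" using nz(2) h0 \<eta> by (simp add: B_def order_less_le)
  have P\<epsilon>: "panjer q (C * q) \<epsilon>" and P\<eta>: "panjer r (C' * r) \<eta>"
    using M.solution(1) T.solution(1) nz unfolding panjer_def pmf_fps_nth q_def C_def r_def C'_def by blast+
  have FZ: "pmf_fps Z * (1 - fps_const (C * q) * fps_X) = fps_const (pmf Z 0) * (1 + fps_const (B * q - C * q) * fps_X)"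
    using M.solution(2) nz(2) unfolding pmf_fps_nth q_def C_def B_def h0_def by blast
  have FW: "pmf_fps W * (1 - fps_const (C' * r) * fps_X) = fps_const (pmf W 0) * (1 + fps_const (B' * r - C' * r) * fps_X)"
    using T.solution(2) nz(1) unfolding pmf_fps_nth r_def C'_def B'_def f0_def by blast
  note b\<epsilon> = panjer_pos_bounds[OF P\<epsilon> \<epsilon>] and b\<eta> = panjer_pos_bounds[OF P\<eta> \<eta>]
  \<comment> \<open>\<open>C'\<close> is read off \<epsilon> by the transposed argument, while the
    recursion of \<epsilon> at n = 1 expresses the same ratio through \<open>C\<close>.\<close>
  have CC: "C' = C"
  proof -
    have "2 * pmf \<epsilon> 2 = (q + C * q) * pmf \<epsilon> 1"
      using P\<epsilon>[unfolded panjer_def, rule_format, of 1] by (simp add: numeral_2_eq_2)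
    then have "pmf \<epsilon> 0 * (2 * pmf \<epsilon> 2) = pmf \<epsilon> 0 * ((q + C * q) * pmf \<epsilon> 1)" by simp
    then have "2 * pmf \<epsilon> 0 * pmf \<epsilon> 2 = pmf \<epsilon> 0 * q * (1 + C) * pmf \<epsilon> 1" by (simp add: algebra_simps)
    also have "pmf \<epsilon> 0 * q = pmf \<epsilon> 1" using \<epsilon>[of 0] by (simp add: q_def)
    finally show ?thesis using \<epsilon>[of 1] by (simp add: C'_def power2_eq_square)
  qed
  \<comment> \<open>The linear coefficient of \<open>Z\<close> equals f0 B q, and \<open>B'\<close>
    divides it by f0 q.\<close>
  have BB: "B' = B"
    using pmf_linear_fractional_fps(1)[OF FZ b\<epsilon>(2,3)] f0 \<epsilon>[of 0] \<epsilon>[of 1]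
    unfolding B'_def q_def f0_def by simp
  define c d where "c = C * q" and "d = C * r"
  have c: "0 \<le> c" "c < 1" and d: "0 \<le> d" "d < 1" using b\<epsilon> b\<eta> by (simp_all add: c_def d_def CC)
  note lZ = pmf_linear_fractional_fps[OF FZ[folded c_def] c, folded f0_def]
  note lW = pmf_linear_fractional_fps[OF FW[unfolded CC BB, folded d_def] d, folded h0_def]
  have "0 < (1 - f0) * (1 - c)" using lZ(3) f0 B q by (metis mult_pos_pos)
  then have f1: "f0 < 1" using c by (simp add: zero_less_mult_iff)
  have "0 < (1 - h0) * (1 - d)" using lW(3) h0 B r by (metis mult_pos_pos)
  then have h1: "h0 < 1" using d by (simp add: zero_less_mult_iff)
  \<comment> \<open>Dividing the probabilities by t^x divides both Panjer parameters by t. By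
    \<open>weight\<close>, this describes the marginal laws.\<close>
  have marg: "panjer (s / t) (e / t) m"
    if "panjer s e n" "\<And>x. pmf m x * t ^ x = K * pmf n x" "t > 0" for s e t K m n
    unfolding panjer_def
  proof
    fix x
    have "real (Suc x) * (pmf m (Suc x) * t ^ Suc x) = (s + e * real x) * (pmf m x * t ^ x)"
      using that(1) unfolding that(2) panjer_def by (simp add: mult.left_commute[of _ K] del: of_nat_Suc)
    then have "(real (Suc x) * pmf m (Suc x) * t) * t ^ x = ((s + e * real x) * pmf m x) * t ^ x"
      by (simp add: mult_ac del: of_nat_Suc)
    then have "real (Suc x) * pmf m (Suc x) * t = (s + e * real x) * pmf m x"
      using that(3) by simp
    then show "real (Suc x) * pmf m (Suc x) = (s / t + e / t * real x) * pmf m x"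
      using that(3) by (simp add: field_simps)
  qed
  have "panjer (q / h0) (c / h0) (map_pmf fst p)"
    using marg[OF P\<epsilon>[folded c_def] M.weight[unfolded pmf_fps_nth, folded h0_def] h0] .
  \<comment> \<open>Normalizability of the law of X: its Panjer ratio c / h0 must be below
    1.\<close>
  from panjer_pos_bounds(3)[OF this M.a_pos] have ch: "c < h0" using h0 by simp
  have "panjer (r / f0) (d / f0) (map_pmf snd p)"
    using marg[OF P\<eta>[unfolded CC, folded d_def] T.weight[unfolded pmf_fps_nth, folded f0_def] f0] .
  from panjer_pos_bounds(3)[OF this M.b_pos] have df: "d < f0" using f0 by simp
  show ?thesis
  proof (cases "C = 0")
    case True
    then have cd: "c = 0" "d = 0" by (simp_all add: c_def d_def)
    have "\<epsilon> = poisson_pmf q"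
      by (rule panjer_eq[of q 0]) (use P\<epsilon> True q panjer_poisson[OF q] in auto)
    moreover have "\<eta> = poisson_pmf r"
      by (rule panjer_eq[of r 0]) (use P\<eta> True CC r panjer_poisson[OF r] in auto)
    moreover have bern: "Q = map_pmf of_bool (bernoulli_pmf (1 - pmf Q 0))"
      if "pmf Q 1 = 1 - pmf Q 0" "\<And>n. n \<ge> 2 \<Longrightarrow> pmf Q n = 0" for Q :: "nat pmf"
    proof (rule pmf_eqI)
      fix n :: nat
      consider "n = 0" | "n = 1" | "n \<ge> 2" by linarith
      then show "pmf Q n = pmf (map_pmf of_bool (bernoulli_pmf (1 - pmf Q 0))) n"
        using that by cases (simp_all add: pmf_bernoulli_nat pmf_le_1)
    qed
    have "Z = map_pmf of_bool (bernoulli_pmf (1 - f0))"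
      unfolding f0_def by (rule bern) (use lZ(1-3) cd in \<open>auto simp: f0_def\<close>)
    moreover have "W = map_pmf of_bool (bernoulli_pmf (1 - h0))"
      unfolding h0_def by (rule bern) (use lW(1-3) cd in \<open>auto simp: h0_def\<close>)
    \<comment> \<open>The Poisson constraint expresses that both directions have the same
      \<open>B\<close>.\<close>
    moreover have "(1 - f0) / (q * f0) = B" "(1 - h0) / (r * h0) = B"
      using lZ(3) lW(3) cd q r f0 h0 by (simp_all add: field_simps)
    ultimately have "poisson_case Z \<epsilon> W \<eta> (1 - f0) (1 - h0) q r"
      using f0 h0 f1 h1 q r by (simp add: poisson_case_def)
    then show ?thesis by blast
  next
    case False
    then have C: "0 < C" using c(1) q by (simp add: c_def zero_le_mult_iff)
    then have cd: "0 < c" "0 < d" using q r by (simp_all add: c_def d_def)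
    \<comment> \<open>Rewriting (f0 + (1 - c - f0) u) / (1 - c u) in powers of 1 - u and dividing
      numerator and denominator by 1 - c gives the first two parameters; the other two come from
      \<open>W\<close>.\<close>
    define \<theta>\<^sub>1 \<theta>\<^sub>2 \<theta>\<^sub>3 \<theta>\<^sub>4 where t: "\<theta>\<^sub>1 = c / (1 - c)" "\<theta>\<^sub>2 = f0 / (1 - c) - 1"
      "\<theta>\<^sub>3 = d / (1 - d)" "\<theta>\<^sub>4 = h0 / (1 - d) - 1"
    \<comment> \<open>A negative binomial law of shape \<delta> has first Panjer parameter \<delta>
      times the second. Here they are s and C s, so the shape is 1 / C in both directions.\<close>
    have nb: "e = neg_binomial_real_pmf (1 / C) (C * s / (1 - C * s))"
      if "panjer s (C * s) e" "0 < s" "C * s < 1" for s e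
    proof (rule panjer_eq[OF that(1)])
      let ?\<theta> = "C * s / (1 - C * s)"
      have th: "0 < ?\<theta>" using that C by simp
      have "1 + ?\<theta> = 1 / (1 - C * s)" using that(3) by (simp add: field_simps)
      then have "?\<theta> / (1 + ?\<theta>) = C * s" using that(3) by simp
      then show "panjer s (C * s) (neg_binomial_real_pmf (1 / C) ?\<theta>)"
        using panjer_neg_binomial_real[OF th, of "1 / C"] C by simp
      show "pmf (neg_binomial_real_pmf (1 / C) ?\<theta>) 0 \<noteq> 0"
        using pmf_neg_binomial_real_pos[OF th, of "1 / C" 0] C by simp
    qed
    have th: "0 < \<theta>\<^sub>1" "0 < \<theta>\<^sub>3" using cd c d by (simp_all add: t)
    have "\<epsilon> = neg_binomial_real_pmf (1 / C) \<theta>\<^sub>1" "\<eta> = neg_binomial_real_pmf (1 / C) \<theta>\<^sub>3"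
      using nb[OF P\<epsilon> q] nb[OF P\<eta>[unfolded CC] r] c d by (simp_all add: t c_def d_def)
    then have pe: "\<forall>u\<in>{0..1}. pgf \<epsilon> u = 1 / (1 + \<theta>\<^sub>1 * (1 - u)) powr (1 / C)"
      "\<forall>u\<in>{0..1}. pgf \<eta> u = 1 / (1 + \<theta>\<^sub>3 * (1 - u)) powr (1 / C)"
      using pgf_neg_binomial_real th C by simp_all
    have lf: "(x + (1 - e - x) * u) / (1 - e * u) = (1 + (x / (1 - e) - 1) * (1 - u)) / (1 + e / (1 - e) * (1 - u))"
      if "e < 1" for x e u :: real
    proof -
      have "1 + (x / (1 - e) - 1) * (1 - u) = (x + (1 - e - x) * u) / (1 - e)"
        "1 + e / (1 - e) * (1 - u) = (1 - e * u) / (1 - e)"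
        using that by (simp_all add: field_simps)
      then show ?thesis using that by simp
    qed
    have pZ: "\<forall>u\<in>{0..1}. pgf Z u = (1 + \<theta>\<^sub>2 * (1 - u)) / (1 + \<theta>\<^sub>1 * (1 - u))"
      and pW: "\<forall>u\<in>{0..1}. pgf W u = (1 + \<theta>\<^sub>4 * (1 - u)) / (1 + \<theta>\<^sub>3 * (1 - u))"
      using lZ(4) lW(4) lf c d unfolding t by simp_all
    have diff: "\<theta>\<^sub>1 - \<theta>\<^sub>2 = (1 - f0) / (1 - c)" "\<theta>\<^sub>3 - \<theta>\<^sub>4 = (1 - h0) / (1 - d)"
    proof -
      have "e / (1 - e) - (x / (1 - e) - 1) = (1 - x) / (1 - e)" if "e < 1" for x e :: real
      proof -
        have "e / (1 - e) + 1 = 1 / (1 - e)" using that by (simp add: field_simps)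
        then show ?thesis unfolding diff_divide_distrib by linarith
      qed
      then show "\<theta>\<^sub>1 - \<theta>\<^sub>2 = (1 - f0) / (1 - c)" "\<theta>\<^sub>3 - \<theta>\<^sub>4 = (1 - h0) / (1 - d)"
        unfolding t using c d by blast+
    qed
    have bounds: "\<theta>\<^sub>2 > -1" "\<theta>\<^sub>4 > -1" "\<theta>\<^sub>1 > \<theta>\<^sub>2" "\<theta>\<^sub>3 > \<theta>\<^sub>4"
    proof -
      have "0 < \<theta>\<^sub>1 - \<theta>\<^sub>2" "0 < \<theta>\<^sub>3 - \<theta>\<^sub>4" unfolding diff using f1 h1 c d by simp_all
      then show "\<theta>\<^sub>1 > \<theta>\<^sub>2" "\<theta>\<^sub>3 > \<theta>\<^sub>4" by simp_all
    qed (use f0 h0 c d in \<open>simp_all add: t\<close>)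
    \<comment> \<open>The product of the slopes is (1 - f0)(1 - h0) / ((1 - c)(1 - d)), and the
      bounds c < h0 and d < f0 from the marginals are paired crosswise.\<close>
    have small: "(\<theta>\<^sub>1 - \<theta>\<^sub>2) * (\<theta>\<^sub>3 - \<theta>\<^sub>4) < 1"
    proof -
      have "(1 - f0) * (1 - h0) < (1 - d) * (1 - c)"
        by (rule mult_strict_mono) (use df ch d f1 h1 in auto)
      then show ?thesis unfolding diff using c d by (simp add: mult.commute)
    qed
    \<comment> \<open>The normalization of \<open>Z\<close> reads f0 m c = (1 - f0)(1 - c), and that
      of \<open>W\<close> has the same form with the same \<open>m\<close>.\<close>
    define m where "m = B / C"
    have m: "0 < m" using B C by (simp add: m_def)
    have rel: "(x / (1 - e) - 1) * (1 + m * (e / (1 - e))) = e / (1 - e) * (1 - m)"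
      if "x * (m * e) = (1 - x) * (1 - e)" "e < 1" for x e :: real
    proof -
      have "((x / (1 - e) - 1) * (1 + m * (e / (1 - e)))) * (1 - e)\<^sup>2
          = (x - (1 - e)) * ((1 - e) + m * e)"
      proof -
        have "(x / (1 - e) - 1) * (1 - e) = x - (1 - e)" "(1 + m * (e / (1 - e))) * (1 - e) = (1 - e) + m * e"
          using that(2) by (simp_all add: field_simps)
        then show ?thesis by (metis (no_types, lifting) mult.assoc mult.left_commute power2_eq_square)
      qed
      also have "\<dots> = (1 - e) * e * (1 - m)" using that(1) by (simp add: algebra_simps)
      also have "\<dots> = (e / (1 - e) * (1 - m)) * (1 - e)\<^sup>2"
        using that(2) by (simp add: power2_eq_square)
      finally show ?thesis
        by (rule mult_right_cancel[THEN iffD1, rotated]) (use that(2) in simp)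
    qed
    have "\<theta>\<^sub>2 * (1 + m * \<theta>\<^sub>1) = \<theta>\<^sub>1 * (1 - m)"
      unfolding t by (rule rel) (use lZ(3) C c in \<open>auto simp: m_def c_def\<close>)
    moreover have "\<theta>\<^sub>4 * (1 + m * \<theta>\<^sub>3) = \<theta>\<^sub>3 * (1 - m)"
      unfolding t by (rule rel) (use lW(3) C d in \<open>auto simp: m_def d_def\<close>)
    ultimately have con: "\<theta>\<^sub>4 * (\<theta>\<^sub>1 + \<theta>\<^sub>3 * (\<theta>\<^sub>1 - \<theta>\<^sub>2)) = \<theta>\<^sub>2 * (\<theta>\<^sub>3 + \<theta>\<^sub>1 * (\<theta>\<^sub>3 - \<theta>\<^sub>4))"
      using neg_binomial_constraint m th by blast
    have "neg_binomial_case Z \<epsilon> W \<eta> (1 / C) \<theta>\<^sub>1 \<theta>\<^sub>2 \<theta>\<^sub>3 \<theta>\<^sub>4"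
      unfolding neg_binomial_case_def using C th bounds pZ pe pW con small by simp
    then show ?thesis by blast
  qed
qed

section \<open>The Poisson-gamma law\<close>

text \<open>Substituting s t for t in Euler's integral for Gamma.\<close>

lemma gamma_kernel_integral:
  fixes a s :: real
  assumes "0 < a" "0 < s"
  shows "(LINT t|lborel. indicator {0..} t * (t powr (a - 1) * exp (- s * t))) = Gamma a / s powr a"
proof -
  define f where "f t = indicator {0..} t * t powr (a - 1) / exp t" for t :: real
  have "(LINT t|lborel. f t) = enn2real (\<integral>\<^sup>+t. ennreal (f t) \<partial>lborel)"
    by (rule integral_eq_nn_integral) (auto simp: f_def)
  also have "(\<integral>\<^sup>+t. ennreal (f t) \<partial>lborel) = ennreal (Gamma a)"
    using Gamma_conv_nn_integral_real[OF assms(1)] by (simp add: f_def)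
  also have "enn2real (ennreal (Gamma a)) = Gamma a"
    using Gamma_real_pos[OF assms(1)] by simp
  finally have G: "(LINT t|lborel. f t) = Gamma a" .
  have *: "f (0 + s * t) = s powr (a - 1) * (indicator {0..} t * (t powr (a - 1) * exp (- s * t)))" for t
    using assms by (auto simp: f_def powr_mult exp_minus divide_inverse zero_le_mult_iff split: split_indicator)
  have "Gamma a = s * (s powr (a - 1) * (LINT t|lborel. indicator {0..} t * (t powr (a - 1) * exp (- s * t))))"
    using lborel_integral_real_affine[of s f 0] assms(2) unfolding G * by simp
  moreover have "s * s powr (a - 1) = s powr a"
    using assms(2) powr_add[of s 1 "a - 1"] by simp
  ultimately have "Gamma a = s powr a * (LINT t|lborel. indicator {0..} t * (t powr (a - 1) * exp (- s * t)))"
    by (simp only: mult.assoc[symmetric])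
  then show ?thesis using assms(2) by simp
qed

text \<open>The product of the gamma density and the two Poisson weights is again a gamma kernel, of
  shape \<delta> + x + y and rate \<open>r + l\<^sub>1 + l\<^sub>2\<close>; the quotient of the two
  Gamma values is the Pochhammer symbol.\<close>

lemma poisson_gamma_integral:
  assumes "0 < \<delta>" "0 < r" "0 < l\<^sub>1" "0 < l\<^sub>2"
  shows "(LINT t|lborel. gamma_density \<delta> r t *
            pmf (pair_pmf (poisson_pmf (l\<^sub>1 * t)) (poisson_pmf (l\<^sub>2 * t))) (x, y))
       = r powr \<delta> * l\<^sub>1 ^ x * l\<^sub>2 ^ y * pochhammer \<delta> (x + y)
           / (fact x * fact y * (r + l\<^sub>1 + l\<^sub>2) powr (\<delta> + real (x + y)))"
proof -
  let ?s = "r + l\<^sub>1 + l\<^sub>2" and ?a = "\<delta> + real (x + y)"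
  let ?K = "r powr \<delta> / Gamma \<delta> * (l\<^sub>1 ^ x / fact x * (l\<^sub>2 ^ y / fact y))"
  have *: "gamma_density \<delta> r t * pmf (pair_pmf (poisson_pmf (l\<^sub>1 * t)) (poisson_pmf (l\<^sub>2 * t))) (x, y)
      = ?K * (indicator {0..} t * (t powr (?a - 1) * exp (- ?s * t)))" for t
  proof (cases "0 < t")
    case True
    have "t powr (?a - 1) = t powr ((\<delta> - 1) + real (x + y))" by (simp add: algebra_simps)
    also have "\<dots> = t powr (\<delta> - 1) * (t ^ x * t ^ y)"
      using True by (simp only: powr_add powr_realpow power_add)
    finally have 1: "t powr (?a - 1) = t powr (\<delta> - 1) * (t ^ x * t ^ y)" .
    have 2: "exp (- ?s * t) = exp (- r * t) * (exp (- (l\<^sub>1 * t)) * exp (- (l\<^sub>2 * t)))"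
      unfolding exp_add[symmetric] by (simp add: algebra_simps)
    show ?thesis
      unfolding 1 2 using True assms by (simp add: gamma_density_def pmf_pair power_mult_distrib)
  next
    case False
    \<comment> \<open>At t = 0 the indicator is 1, but the factor \<open>0 powr _\<close> is
      0.\<close>
    then show ?thesis by (auto simp: gamma_density_def split: split_indicator)
  qed
  have G: "Gamma ?a = pochhammer \<delta> (x + y) * Gamma \<delta>"
  proof -
    have "\<delta> \<notin> \<int>\<^sub>\<le>\<^sub>0" using assms(1) nonpos_Ints_nonpos[of \<delta>] by auto
    from pochhammer_Gamma[OF this, of "x + y"] show ?thesis
      using Gamma_real_pos[OF assms(1)] by simp
  qed
  have "(LINT t|lborel. indicator {0..} t * (t powr (?a - 1) * exp (- ?s * t)))
      = pochhammer \<delta> (x + y) * Gamma \<delta> / ?s powr ?a"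
    unfolding G[symmetric] by (rule gamma_kernel_integral) (use assms in auto)
  moreover have "Gamma \<delta> \<noteq> 0" using Gamma_real_pos[OF assms(1)] by simp
  ultimately show ?thesis
    unfolding * integral_mult_right_zero by (simp only:) (simp add: mult_ac)
qed

lemma poisson_gamma_law_iff:
  assumes "0 < \<delta>" "0 < r" "0 < l\<^sub>1" "0 < l\<^sub>2"
  shows "poisson_gamma_law p \<delta> r l\<^sub>1 l\<^sub>2 \<longleftrightarrow>
    (\<forall>x y. pmf p (x, y) = r powr \<delta> * l\<^sub>1 ^ x * l\<^sub>2 ^ y * pochhammer \<delta> (x + y)
           / (fact x * fact y * (r + l\<^sub>1 + l\<^sub>2) powr (\<delta> + real (x + y))))"
  unfolding poisson_gamma_law_def split_paired_All poisson_gamma_integral[OF assms] ..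

text \<open>Replacing U by r U gives it rate 1 and divides both Poisson coefficients by r.\<close>

lemma poisson_gamma_law_scale:
  assumes "0 < \<delta>" "0 < r" "0 < l\<^sub>1" "0 < l\<^sub>2"
  shows "poisson_gamma_law p \<delta> r l\<^sub>1 l\<^sub>2 \<longleftrightarrow> poisson_gamma_law p \<delta> 1 (l\<^sub>1 / r) (l\<^sub>2 / r)"
proof -
  have "r powr \<delta> * l\<^sub>1 ^ x * l\<^sub>2 ^ y * P / (F * (r + l\<^sub>1 + l\<^sub>2) powr (\<delta> + real (x + y)))
      = 1 powr \<delta> * (l\<^sub>1 / r) ^ x * (l\<^sub>2 / r) ^ y * P / (F * (1 + l\<^sub>1 / r + l\<^sub>2 / r) powr (\<delta> + real (x + y)))"
    for P F x y
  proof -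
    have "1 + l\<^sub>1 / r + l\<^sub>2 / r = (r + l\<^sub>1 + l\<^sub>2) / r" using assms by (simp add: field_simps)
    then have "(1 + l\<^sub>1 / r + l\<^sub>2 / r) powr (\<delta> + real (x + y))
        = (r + l\<^sub>1 + l\<^sub>2) powr (\<delta> + real (x + y)) / (r powr \<delta> * (r ^ x * r ^ y))"
      using assms powr_realpow[of r "x + y"] by (simp add: powr_divide powr_add power_add)
    then show ?thesis using assms by (simp add: power_divide mult_ac)
  qed
  then show ?thesis
    using assms by (subst (1 2) poisson_gamma_law_iff) (simp_all del: powr_one_eq_one)
qed

text \<open>With vanishing numerator parameter, f^y g is the power -(\<delta> + y) of the common
  denominator, so X given Y = y is negative binomial of shape \<delta> + y. Multiplied by the
  marginal of Y, this is the closed form of the gamma mixture with rate 1.\<close>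

lemma neg_binomial_case_poisson_gamma:
  assumes R: "regular_bivariate_car p Z \<epsilon> W \<eta>" and N: "neg_binomial_case Z \<epsilon> W \<eta> \<delta> \<theta>\<^sub>1 0 \<theta>\<^sub>3 0"
    and X_def: "\<theta>\<^sub>X = \<theta>\<^sub>1 * (1 + \<theta>\<^sub>3) / (1 - \<theta>\<^sub>1 * \<theta>\<^sub>3)" and Y_def: "\<theta>\<^sub>Y = \<theta>\<^sub>3 * (1 + \<theta>\<^sub>1) / (1 - \<theta>\<^sub>1 * \<theta>\<^sub>3)"
  shows "0 < \<theta>\<^sub>X" "0 < \<theta>\<^sub>Y" "poisson_gamma_law p \<delta> 1 \<theta>\<^sub>X \<theta>\<^sub>Y"
proof -
  have t: "0 < \<delta>" "0 < \<theta>\<^sub>1" "0 < \<theta>\<^sub>3" "\<theta>\<^sub>1 * \<theta>\<^sub>3 < 1" using N by (auto simp: neg_binomial_case_def)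
  obtain p' where p': "regular_bivariate_car p' Z \<epsilon> W \<eta>" and X: "0 < \<theta>\<^sub>X" and Y: "0 < \<theta>\<^sub>Y"
    and \<epsilon>: "\<epsilon> = neg_binomial_real_pmf \<delta> \<theta>\<^sub>1"
    and joint: "p' = joint_of (neg_binomial_real_pmf \<delta> \<theta>\<^sub>Y) (compound_pmf Z \<epsilon>)"
    by (rule neg_binomial_case_regular[OF N refl, of \<theta>\<^sub>X \<theta>\<^sub>Y]) (auto simp: X_def Y_def algebra_simps)
  show "0 < \<theta>\<^sub>X" "0 < \<theta>\<^sub>Y" by fact+
  have p: "p = p'" by (rule regular_bivariate_car_unique[OF R p'])
  have comp: "compound_pmf Z \<epsilon> y = neg_binomial_real_pmf (\<delta> + real y) \<theta>\<^sub>1" for y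
  proof (rule neg_binomial_real_eqI[OF t(2)])
    fix u :: real assume u: "0 \<le> u" "u \<le> 1"
    have pos: "0 < 1 + \<theta>\<^sub>1 * (1 - u)" using u t by (intro add_pos_nonneg) auto
    have "pgf Z u = 1 / (1 + \<theta>\<^sub>1 * (1 - u))" using N u by (simp add: neg_binomial_case_def)
    then show "pgf (compound_pmf Z \<epsilon> y) u = 1 / (1 + \<theta>\<^sub>1 * (1 - u)) powr (\<delta> + real y)"
      unfolding pgf_compound[OF u] \<epsilon> pgf_neg_binomial_real[OF t(2,1) u]
      using pos by (simp add: powr_add powr_realpow power_divide)
  qed (use t in simp)
  \<comment> \<open>The aim is the factorization of
    \<open>1 + \<theta>\<^sub>X + \<theta>\<^sub>Y\<close>, the base in the mixture formula, into
    the bases of the conditional and the marginal law.\<close>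
  have "1 + \<theta>\<^sub>Y = (1 + \<theta>\<^sub>3) / (1 - \<theta>\<^sub>1 * \<theta>\<^sub>3)" using t by (simp add: Y_def field_simps)
  then have XY: "\<theta>\<^sub>X = \<theta>\<^sub>1 * (1 + \<theta>\<^sub>Y)" by (simp add: X_def)
  then have S: "1 + \<theta>\<^sub>X + \<theta>\<^sub>Y = (1 + \<theta>\<^sub>1) * (1 + \<theta>\<^sub>Y)" by (simp add: algebra_simps)
  have "pmf p (x, y) = 1 powr \<delta> * \<theta>\<^sub>X ^ x * \<theta>\<^sub>Y ^ y * pochhammer \<delta> (x + y)
           / (fact x * fact y * (1 + \<theta>\<^sub>X + \<theta>\<^sub>Y) powr (\<delta> + real (x + y)))" for x y
  proof -
    define A B where "A = 1 + \<theta>\<^sub>1" and "B = 1 + \<theta>\<^sub>Y"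
    have AB: "0 < A" "0 < B" using t Y by (simp_all add: A_def B_def)
    have poch: "pochhammer \<delta> (x + y) = pochhammer \<delta> y * pochhammer (\<delta> + real y) x"
      using pochhammer_product'[of \<delta> y x] by (simp add: add.commute)
    have "pmf p (x, y) = (pochhammer \<delta> y / fact y * (\<theta>\<^sub>Y / B) ^ y * B powr (- \<delta>)) *
        (pochhammer (\<delta> + real y) x / fact x * (\<theta>\<^sub>1 / A) ^ x * A powr (- (\<delta> + real y)))"
      unfolding p joint pmf_joint_of comp A_def B_def
      using t Y by (subst (1 2) pmf_neg_binomial_real) auto
    also have "\<dots> = pochhammer \<delta> y * pochhammer (\<delta> + real y) x * \<theta>\<^sub>1 ^ x * \<theta>\<^sub>Y ^ y
        / (fact x * fact y * (A powr \<delta> * B powr \<delta> * (A ^ x * A ^ y * B ^ y)))"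
    proof -
      have "A powr (- (\<delta> + real y)) = 1 / (A powr \<delta> * A ^ y)"
        using AB by (simp only: powr_minus_divide powr_add powr_realpow)
      then show ?thesis by (simp only: powr_minus_divide power_divide) (simp add: mult_ac)
    qed
    also have "\<dots> = \<theta>\<^sub>X ^ x * \<theta>\<^sub>Y ^ y * pochhammer \<delta> (x + y) / (fact x * fact y * (A * B) powr (\<delta> + real (x + y)))"
    proof -
      have "(A * B) powr (\<delta> + real (x + y)) = A powr \<delta> * B powr \<delta> * (A ^ x * A ^ y * B ^ y) * B ^ x"
        using AB powr_realpow[of "A * B" "x + y"] by (simp add: powr_add powr_mult power_add power_mult_distrib)
      moreover have "\<theta>\<^sub>X ^ x = \<theta>\<^sub>1 ^ x * B ^ x" by (simp add: XY B_def power_mult_distrib)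
      ultimately show ?thesis unfolding poch using AB by (simp add: mult_ac)
    qed
    finally show ?thesis by (simp add: S A_def B_def)
  qed
  then show "poisson_gamma_law p \<delta> 1 \<theta>\<^sub>X \<theta>\<^sub>Y"
    using t X Y by (subst poisson_gamma_law_iff) auto
qed

text \<open>For the converse, parameters are matched so that the autoregressive law has the
  prescribed gamma mixture as its closed form; the mixture formula then identifies it with
  \<open>p\<close>.\<close>

lemma poisson_gamma_iff:
  assumes d: "0 < \<delta>"
  shows "(\<exists>Z \<epsilon> W \<eta> \<theta>\<^sub>1 \<theta>\<^sub>3. regular_bivariate_car p Z \<epsilon> W \<eta> \<and> neg_binomial_case Z \<epsilon> W \<eta> \<delta> \<theta>\<^sub>1 0 \<theta>\<^sub>3 0) \<longleftrightarrow>
         (\<exists>r>0. \<exists>l\<^sub>1>0. \<exists>l\<^sub>2>0. poisson_gamma_law p \<delta> r l\<^sub>1 l\<^sub>2)"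
proof
  assume "\<exists>Z \<epsilon> W \<eta> \<theta>\<^sub>1 \<theta>\<^sub>3. regular_bivariate_car p Z \<epsilon> W \<eta> \<and> neg_binomial_case Z \<epsilon> W \<eta> \<delta> \<theta>\<^sub>1 0 \<theta>\<^sub>3 0"
  then obtain Z \<epsilon> W \<eta> \<theta>\<^sub>1 \<theta>\<^sub>3 where
    "regular_bivariate_car p Z \<epsilon> W \<eta>" "neg_binomial_case Z \<epsilon> W \<eta> \<delta> \<theta>\<^sub>1 0 \<theta>\<^sub>3 0"
    by blast
  from neg_binomial_case_poisson_gamma[OF this refl refl]
  show "\<exists>r>0. \<exists>l\<^sub>1>0. \<exists>l\<^sub>2>0. poisson_gamma_law p \<delta> r l\<^sub>1 l\<^sub>2"
    using zero_less_one by blast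
next
  assume "\<exists>r>0. \<exists>l\<^sub>1>0. \<exists>l\<^sub>2>0. poisson_gamma_law p \<delta> r l\<^sub>1 l\<^sub>2"
  then obtain r l\<^sub>1 l\<^sub>2 where l: "0 < r" "0 < l\<^sub>1" "0 < l\<^sub>2" and law: "poisson_gamma_law p \<delta> r l\<^sub>1 l\<^sub>2" by blast
  \<comment> \<open>Given Y = y, U is gamma distributed with rate \<open>r + l\<^sub>2\<close>, so X
    is negative binomial with parameter \<open>l\<^sub>1 / (r + l\<^sub>2)\<close>; symmetrically
    for Y given X.\<close>
  define \<theta>\<^sub>1 \<theta>\<^sub>3 where t_def: "\<theta>\<^sub>1 = l\<^sub>1 / (r + l\<^sub>2)" "\<theta>\<^sub>3 = l\<^sub>2 / (r + l\<^sub>1)"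
  have t: "0 < \<theta>\<^sub>1" "0 < \<theta>\<^sub>3" using l by (simp_all add: t_def)
  have prod: "1 - \<theta>\<^sub>1 * \<theta>\<^sub>3 = r * (r + l\<^sub>1 + l\<^sub>2) / ((r + l\<^sub>2) * (r + l\<^sub>1))"
  proof -
    have "(r + l\<^sub>2) * (r + l\<^sub>1) \<noteq> 0" using l by simp
    then have "1 - \<theta>\<^sub>1 * \<theta>\<^sub>3 = ((r + l\<^sub>2) * (r + l\<^sub>1) - l\<^sub>1 * l\<^sub>2) / ((r + l\<^sub>2) * (r + l\<^sub>1))"
      unfolding diff_divide_distrib t_def by simp
    also have "(r + l\<^sub>2) * (r + l\<^sub>1) - l\<^sub>1 * l\<^sub>2 = r * (r + l\<^sub>1 + l\<^sub>2)" by (simp add: algebra_simps)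
    finally show ?thesis .
  qed
  have "0 < r * (r + l\<^sub>1 + l\<^sub>2) / ((r + l\<^sub>2) * (r + l\<^sub>1))"
    using l by (intro divide_pos_pos mult_pos_pos) auto
  with prod have small: "\<theta>\<^sub>1 * \<theta>\<^sub>3 < 1" by linarith
  define nb where "nb = neg_binomial_real_pmf"
  have geo: "pgf (nb 1 \<theta>) u = 1 / (1 + \<theta> * (1 - u))" if "0 < \<theta>" "0 \<le> u" "u \<le> 1" for \<theta> u
  proof -
    have "0 < 1 + \<theta> * (1 - u)" using that by (intro add_pos_nonneg) auto
    then show ?thesis unfolding nb_def using that by (simp add: pgf_neg_binomial_real)
  qed
  \<comment> \<open>With \<open>\<theta>\<^sub>2 = \<theta>\<^sub>4 = 0\<close> the summands are
    geometric, that is negative binomial of shape 1.\<close>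
  have N: "neg_binomial_case (nb 1 \<theta>\<^sub>1) (nb \<delta> \<theta>\<^sub>1) (nb 1 \<theta>\<^sub>3) (nb \<delta> \<theta>\<^sub>3) \<delta> \<theta>\<^sub>1 0 \<theta>\<^sub>3 0"
    unfolding neg_binomial_case_def using t small d geo
    by (simp add: nb_def pgf_neg_binomial_real)
  obtain p' where R: "regular_bivariate_car p' (nb 1 \<theta>\<^sub>1) (nb \<delta> \<theta>\<^sub>1) (nb 1 \<theta>\<^sub>3) (nb \<delta> \<theta>\<^sub>3)"
    using neg_binomial_case_regular[OF N refl refl refl] by blast
  have "1 + \<theta>\<^sub>3 = (r + l\<^sub>1 + l\<^sub>2) / (r + l\<^sub>1)" "1 + \<theta>\<^sub>1 = (r + l\<^sub>1 + l\<^sub>2) / (r + l\<^sub>2)"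
    using l by (simp_all add: t_def field_simps)
  then have "l\<^sub>1 / r = \<theta>\<^sub>1 * (1 + \<theta>\<^sub>3) / (1 - \<theta>\<^sub>1 * \<theta>\<^sub>3)" "l\<^sub>2 / r = \<theta>\<^sub>3 * (1 + \<theta>\<^sub>1) / (1 - \<theta>\<^sub>1 * \<theta>\<^sub>3)"
    unfolding prod using l add_pos_pos[OF add_pos_pos[OF l(1,2)] l(3)] by (simp_all add: t_def)
  then have "poisson_gamma_law p' \<delta> 1 (l\<^sub>1 / r) (l\<^sub>2 / r)"
    by (rule neg_binomial_case_poisson_gamma(3)[OF R N])
  then have "poisson_gamma_law p' \<delta> r l\<^sub>1 l\<^sub>2" using poisson_gamma_law_scale d l by blast
  then have "p = p'" using law unfolding poisson_gamma_law_def by (metis pmf_eqI)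
  then show "\<exists>Z \<epsilon> W \<eta> \<theta>\<^sub>1 \<theta>\<^sub>3. regular_bivariate_car p Z \<epsilon> W \<eta> \<and> neg_binomial_case Z \<epsilon> W \<eta> \<delta> \<theta>\<^sub>1 0 \<theta>\<^sub>3 0"
    using R N by blast
qed

section \<open>Properties of every solution and the final statement\<close>

text \<open>The marginals are known for the explicitly constructed law and pass to \<open>p\<close>
  by uniqueness; the expectations come directly from the compound form of the conditional
  laws.\<close>

lemma poisson_case_conclusions:
  assumes R: "regular_bivariate_car p Z \<epsilon> W \<eta>" and P: "poisson_case Z \<epsilon> W \<eta> \<alpha> \<beta> l\<^sub>\<epsilon> l\<^sub>\<eta>"
  shows "map_pmf fst p = poisson_pmf ((\<alpha> * l\<^sub>\<eta> + l\<^sub>\<epsilon>) / (1 - \<alpha> * \<beta>))"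
    and "map_pmf snd p = poisson_pmf ((\<beta> * l\<^sub>\<epsilon> + l\<^sub>\<eta>) / (1 - \<alpha> * \<beta>))"
    and "measure_pmf.expectation (X_given_Y p y) real = \<alpha> * real y + l\<^sub>\<epsilon>"
    and "measure_pmf.expectation (Y_given_X p x) real = \<beta> * real x + l\<^sub>\<eta>"
proof -
  obtain p' where p': "regular_bivariate_car p' Z \<epsilon> W \<eta>"
    "map_pmf fst p' = poisson_pmf ((\<alpha> * l\<^sub>\<eta> + l\<^sub>\<epsilon>) / (1 - \<alpha> * \<beta>))"
    "map_pmf snd p' = poisson_pmf ((\<beta> * l\<^sub>\<epsilon> + l\<^sub>\<eta>) / (1 - \<alpha> * \<beta>))"
    using poisson_case_regular[OF P] by blast
  then show "map_pmf fst p = poisson_pmf ((\<alpha> * l\<^sub>\<eta> + l\<^sub>\<epsilon>) / (1 - \<alpha> * \<beta>))"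
    and "map_pmf snd p = poisson_pmf ((\<beta> * l\<^sub>\<epsilon> + l\<^sub>\<eta>) / (1 - \<alpha> * \<beta>))"
    using regular_bivariate_car_unique[OF R p'(1)] by simp_all
  have b: "measure_pmf.expectation (map_pmf of_bool (bernoulli_pmf a)) real = a" if "0 \<le> a" "a < 1" for a
    using that by simp
  show "measure_pmf.expectation (X_given_Y p y) real = \<alpha> * real y + l\<^sub>\<epsilon>"
    and "measure_pmf.expectation (Y_given_X p x) real = \<beta> * real x + l\<^sub>\<eta>"
    using P b unfolding conditional_expectations[OF R] poisson_case_def by (auto simp: expectation_poisson mult.commute)
qed

theorem theorem2:
  fixes Z \<epsilon> W \<eta> :: "nat pmf"
  shows
    "((\<exists>\<alpha> \<beta> l\<^sub>\<epsilon> l\<^sub>\<eta>. poisson_case Z \<epsilon> W \<eta> \<alpha> \<beta> l\<^sub>\<epsilon> l\<^sub>\<eta>) \<or>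
      (\<exists>\<delta> \<theta>\<^sub>1 \<theta>\<^sub>2 \<theta>\<^sub>3 \<theta>\<^sub>4. neg_binomial_case Z \<epsilon> W \<eta> \<delta> \<theta>\<^sub>1 \<theta>\<^sub>2 \<theta>\<^sub>3 \<theta>\<^sub>4)
        \<longrightarrow> (\<exists>p. regular_bivariate_car p Z \<epsilon> W \<eta>)) \<and>
     ((\<exists>p. regular_bivariate_car p Z \<epsilon> W \<eta>) \<and> \<not> (Z = return_pmf 0 \<and> W = return_pmf 0)
        \<longrightarrow> (\<exists>\<alpha> \<beta> l\<^sub>\<epsilon> l\<^sub>\<eta>. poisson_case Z \<epsilon> W \<eta> \<alpha> \<beta> l\<^sub>\<epsilon> l\<^sub>\<eta>) \<or>
            (\<exists>\<delta> \<theta>\<^sub>1 \<theta>\<^sub>2 \<theta>\<^sub>3 \<theta>\<^sub>4. neg_binomial_case Z \<epsilon> W \<eta> \<delta> \<theta>\<^sub>1 \<theta>\<^sub>2 \<theta>\<^sub>3 \<theta>\<^sub>4)) \<and>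
     (\<forall>p \<alpha> \<beta> l\<^sub>\<epsilon> l\<^sub>\<eta>. regular_bivariate_car p Z \<epsilon> W \<eta> \<and> poisson_case Z \<epsilon> W \<eta> \<alpha> \<beta> l\<^sub>\<epsilon> l\<^sub>\<eta> \<longrightarrow>
        map_pmf fst p = poisson_pmf ((\<alpha> * l\<^sub>\<eta> + l\<^sub>\<epsilon>) / (1 - \<alpha> * \<beta>)) \<and>
        map_pmf snd p = poisson_pmf ((\<beta> * l\<^sub>\<epsilon> + l\<^sub>\<eta>) / (1 - \<alpha> * \<beta>)) \<and>
        (\<forall>y. measure_pmf.expectation (X_given_Y p y) real = \<alpha> * real y + l\<^sub>\<epsilon>) \<and>
        (\<forall>x. measure_pmf.expectation (Y_given_X p x) real = \<beta> * real x + l\<^sub>\<eta>)) \<and>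
     (\<forall>p \<delta> \<theta>\<^sub>1 \<theta>\<^sub>2 \<theta>\<^sub>3 \<theta>\<^sub>4.
        regular_bivariate_car p Z \<epsilon> W \<eta> \<and> neg_binomial_case Z \<epsilon> W \<eta> \<delta> \<theta>\<^sub>1 \<theta>\<^sub>2 \<theta>\<^sub>3 \<theta>\<^sub>4 \<longrightarrow>
        (let \<Delta> = 1 - (\<theta>\<^sub>1 - \<theta>\<^sub>2) * (\<theta>\<^sub>3 - \<theta>\<^sub>4);
             \<theta>\<^sub>X = (\<theta>\<^sub>1 + \<theta>\<^sub>3 * (\<theta>\<^sub>1 - \<theta>\<^sub>2)) / \<Delta>;
             \<theta>\<^sub>Y = (\<theta>\<^sub>3 + \<theta>\<^sub>1 * (\<theta>\<^sub>3 - \<theta>\<^sub>4)) / \<Delta>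
         in (\<forall>u\<in>{0..1}. pgf (map_pmf fst p) u = 1 / (1 + \<theta>\<^sub>X * (1 - u)) powr \<delta>) \<and>
            (\<forall>v\<in>{0..1}. pgf (map_pmf snd p) v = 1 / (1 + \<theta>\<^sub>Y * (1 - v)) powr \<delta>) \<and>
            (\<forall>u\<in>{0..1}. \<forall>v\<in>{0..1}. joint_pgf p u v =
               1 / (1 + \<theta>\<^sub>X * (1 - u) + \<theta>\<^sub>Y * (1 - v) + \<theta>\<^sub>4 * \<theta>\<^sub>X * (1 - u) * (1 - v)) powr \<delta>) \<and>
            \<theta>\<^sub>4 * \<theta>\<^sub>X = \<theta>\<^sub>2 * \<theta>\<^sub>Y \<and>
            (\<forall>y. measure_pmf.expectation (X_given_Y p y) real = (\<theta>\<^sub>1 - \<theta>\<^sub>2) * real y + \<delta> * \<theta>\<^sub>1) \<and>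
            (\<forall>x. measure_pmf.expectation (Y_given_X p x) real = (\<theta>\<^sub>3 - \<theta>\<^sub>4) * real x + \<delta> * \<theta>\<^sub>3))) \<and>
     (\<forall>p. \<forall>\<delta>>0.
        (\<exists>Z \<epsilon> W \<eta> \<theta>\<^sub>1 \<theta>\<^sub>3. regular_bivariate_car p Z \<epsilon> W \<eta> \<and>
           neg_binomial_case Z \<epsilon> W \<eta> \<delta> \<theta>\<^sub>1 0 \<theta>\<^sub>3 0) \<longleftrightarrow>
        (\<exists>r>0. \<exists>l\<^sub>1>0. \<exists>l\<^sub>2>0. poisson_gamma_law p \<delta> r l\<^sub>1 l\<^sub>2))"
proof (intro conjI allI impI)
  assume "(\<exists>\<alpha> \<beta> l\<^sub>\<epsilon> l\<^sub>\<eta>. poisson_case Z \<epsilon> W \<eta> \<alpha> \<beta> l\<^sub>\<epsilon> l\<^sub>\<eta>) \<or>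
      (\<exists>\<delta> \<theta>\<^sub>1 \<theta>\<^sub>2 \<theta>\<^sub>3 \<theta>\<^sub>4. neg_binomial_case Z \<epsilon> W \<eta> \<delta> \<theta>\<^sub>1 \<theta>\<^sub>2 \<theta>\<^sub>3 \<theta>\<^sub>4)"
  then show "\<exists>p. regular_bivariate_car p Z \<epsilon> W \<eta>"
    using poisson_case_regular neg_binomial_case_regular[OF _ refl refl refl] by metis
next
  assume "(\<exists>p. regular_bivariate_car p Z \<epsilon> W \<eta>) \<and> \<not> (Z = return_pmf 0 \<and> W = return_pmf 0)"
  then show "(\<exists>\<alpha> \<beta> l\<^sub>\<epsilon> l\<^sub>\<eta>. poisson_case Z \<epsilon> W \<eta> \<alpha> \<beta> l\<^sub>\<epsilon> l\<^sub>\<eta>) \<or>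
      (\<exists>\<delta> \<theta>\<^sub>1 \<theta>\<^sub>2 \<theta>\<^sub>3 \<theta>\<^sub>4. neg_binomial_case Z \<epsilon> W \<eta> \<delta> \<theta>\<^sub>1 \<theta>\<^sub>2 \<theta>\<^sub>3 \<theta>\<^sub>4)"
    using regular_imp_cases by blast
next
  fix p \<delta> \<theta>\<^sub>1 \<theta>\<^sub>2 \<theta>\<^sub>3 \<theta>\<^sub>4
  assume "regular_bivariate_car p Z \<epsilon> W \<eta> \<and> neg_binomial_case Z \<epsilon> W \<eta> \<delta> \<theta>\<^sub>1 \<theta>\<^sub>2 \<theta>\<^sub>3 \<theta>\<^sub>4"
  then have R: "regular_bivariate_car p Z \<epsilon> W \<eta>" and N: "neg_binomial_case Z \<epsilon> W \<eta> \<delta> \<theta>\<^sub>1 \<theta>\<^sub>2 \<theta>\<^sub>3 \<theta>\<^sub>4"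
    by blast+
  define \<Delta> where "\<Delta> = 1 - (\<theta>\<^sub>1 - \<theta>\<^sub>2) * (\<theta>\<^sub>3 - \<theta>\<^sub>4)"
  define \<theta>\<^sub>X where "\<theta>\<^sub>X = (\<theta>\<^sub>1 + \<theta>\<^sub>3 * (\<theta>\<^sub>1 - \<theta>\<^sub>2)) / \<Delta>"
  define \<theta>\<^sub>Y where "\<theta>\<^sub>Y = (\<theta>\<^sub>3 + \<theta>\<^sub>1 * (\<theta>\<^sub>3 - \<theta>\<^sub>4)) / \<Delta>"
  have t: "0 < \<delta>" "0 < \<theta>\<^sub>1" "0 < \<theta>\<^sub>3" using N by (auto simp: neg_binomial_case_def)
  obtain p' where p': "regular_bivariate_car p' Z \<epsilon> W \<eta>"
    and fst: "map_pmf fst p' = neg_binomial_real_pmf \<delta> \<theta>\<^sub>X"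
    and snd: "map_pmf snd p' = neg_binomial_real_pmf \<delta> \<theta>\<^sub>Y"
    and pos: "0 < \<theta>\<^sub>X" "0 < \<theta>\<^sub>Y" and XY: "\<theta>\<^sub>4 * \<theta>\<^sub>X = \<theta>\<^sub>2 * \<theta>\<^sub>Y"
    and joint: "\<forall>u\<in>{0..1}. \<forall>v\<in>{0..1}. joint_pgf p' u v =
       1 / (1 + \<theta>\<^sub>X * (1 - u) + \<theta>\<^sub>Y * (1 - v) + \<theta>\<^sub>4 * \<theta>\<^sub>X * (1 - u) * (1 - v)) powr \<delta>"
    and innov: "\<epsilon> = neg_binomial_real_pmf \<delta> \<theta>\<^sub>1" "\<eta> = neg_binomial_real_pmf \<delta> \<theta>\<^sub>3"
    and "p' = joint_of (neg_binomial_real_pmf \<delta> \<theta>\<^sub>Y) (compound_pmf Z \<epsilon>)"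
    by (rule neg_binomial_case_regular[OF N \<Delta>_def \<theta>\<^sub>X_def \<theta>\<^sub>Y_def])
  \<comment> \<open>Uniqueness transfers the marginals and the joint generating function from the
    constructed law to the given one.\<close>
  have p: "p' = p" by (rule regular_bivariate_car_unique[OF p' R])
  have eZ: "measure_pmf.expectation Z real = \<theta>\<^sub>1 - \<theta>\<^sub>2"
    by (rule expectation_linear_fractional[OF t(2)]) (use N in \<open>auto simp: neg_binomial_case_def\<close>)
  have eW: "measure_pmf.expectation W real = \<theta>\<^sub>3 - \<theta>\<^sub>4"
    by (rule expectation_linear_fractional[OF t(3)]) (use N in \<open>auto simp: neg_binomial_case_def\<close>)
  have ee: "measure_pmf.expectation \<epsilon> real = \<delta> * \<theta>\<^sub>1" "measure_pmf.expectation \<eta> real = \<delta> * \<theta>\<^sub>3"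
    using t by (simp_all add: innov expectation_neg_binomial_real)
  have ce: "measure_pmf.expectation (X_given_Y p y) real = (\<theta>\<^sub>1 - \<theta>\<^sub>2) * real y + \<delta> * \<theta>\<^sub>1"
    "measure_pmf.expectation (Y_given_X p x) real = (\<theta>\<^sub>3 - \<theta>\<^sub>4) * real x + \<delta> * \<theta>\<^sub>3" for x y
    unfolding conditional_expectations[OF R] eZ eW ee by (simp_all only: mult.commute)
  have marg: "\<forall>u\<in>{0..1}. pgf (map_pmf fst p) u = 1 / (1 + \<theta>\<^sub>X * (1 - u)) powr \<delta>"
    "\<forall>v\<in>{0..1}. pgf (map_pmf snd p) v = 1 / (1 + \<theta>\<^sub>Y * (1 - v)) powr \<delta>"
    using pgf_neg_binomial_real[OF pos(1) t(1)] pgf_neg_binomial_real[OF pos(2) t(1)]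
    by (simp_all add: fst[unfolded p] snd[unfolded p])
  show "let \<Delta> = 1 - (\<theta>\<^sub>1 - \<theta>\<^sub>2) * (\<theta>\<^sub>3 - \<theta>\<^sub>4);
             \<theta>\<^sub>X = (\<theta>\<^sub>1 + \<theta>\<^sub>3 * (\<theta>\<^sub>1 - \<theta>\<^sub>2)) / \<Delta>;
             \<theta>\<^sub>Y = (\<theta>\<^sub>3 + \<theta>\<^sub>1 * (\<theta>\<^sub>3 - \<theta>\<^sub>4)) / \<Delta>
         in (\<forall>u\<in>{0..1}. pgf (map_pmf fst p) u = 1 / (1 + \<theta>\<^sub>X * (1 - u)) powr \<delta>) \<and>
            (\<forall>v\<in>{0..1}. pgf (map_pmf snd p) v = 1 / (1 + \<theta>\<^sub>Y * (1 - v)) powr \<delta>) \<and>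
            (\<forall>u\<in>{0..1}. \<forall>v\<in>{0..1}. joint_pgf p u v =
               1 / (1 + \<theta>\<^sub>X * (1 - u) + \<theta>\<^sub>Y * (1 - v) + \<theta>\<^sub>4 * \<theta>\<^sub>X * (1 - u) * (1 - v)) powr \<delta>) \<and>
            \<theta>\<^sub>4 * \<theta>\<^sub>X = \<theta>\<^sub>2 * \<theta>\<^sub>Y \<and>
            (\<forall>y. measure_pmf.expectation (X_given_Y p y) real = (\<theta>\<^sub>1 - \<theta>\<^sub>2) * real y + \<delta> * \<theta>\<^sub>1) \<and>
            (\<forall>x. measure_pmf.expectation (Y_given_X p x) real = (\<theta>\<^sub>3 - \<theta>\<^sub>4) * real x + \<delta> * \<theta>\<^sub>3)"
    unfolding Let_def \<Delta>_def[symmetric] \<theta>\<^sub>X_def[symmetric] \<theta>\<^sub>Y_def[symmetric]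
    using marg joint[unfolded p] XY ce by blast
next
  fix p and \<delta> :: real assume "\<delta> > 0"
  then show "(\<exists>Z \<epsilon> W \<eta> \<theta>\<^sub>1 \<theta>\<^sub>3. regular_bivariate_car p Z \<epsilon> W \<eta> \<and>
           neg_binomial_case Z \<epsilon> W \<eta> \<delta> \<theta>\<^sub>1 0 \<theta>\<^sub>3 0) \<longleftrightarrow>
        (\<exists>r>0. \<exists>l\<^sub>1>0. \<exists>l\<^sub>2>0. poisson_gamma_law p \<delta> r l\<^sub>1 l\<^sub>2)"
    by (rule poisson_gamma_iff)
next
  fix p \<alpha> \<beta> l\<^sub>\<epsilon> l\<^sub>\<eta>
  assume "regular_bivariate_car p Z \<epsilon> W \<eta> \<and> poisson_case Z \<epsilon> W \<eta> \<alpha> \<beta> l\<^sub>\<epsilon> l\<^sub>\<eta>"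
  then have R: "regular_bivariate_car p Z \<epsilon> W \<eta>" and P: "poisson_case Z \<epsilon> W \<eta> \<alpha> \<beta> l\<^sub>\<epsilon> l\<^sub>\<eta>" by blast+
  show "map_pmf fst p = poisson_pmf ((\<alpha> * l\<^sub>\<eta> + l\<^sub>\<epsilon>) / (1 - \<alpha> * \<beta>))"
    and "map_pmf snd p = poisson_pmf ((\<beta> * l\<^sub>\<epsilon> + l\<^sub>\<eta>) / (1 - \<alpha> * \<beta>))"
    and "measure_pmf.expectation (X_given_Y p y) real = \<alpha> * real y + l\<^sub>\<epsilon>"
    and "measure_pmf.expectation (Y_given_X p x) real = \<beta> * real x + l\<^sub>\<eta>" for x y
    by (rule poisson_case_conclusions[OF R P])+
qed

end
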